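(* Let $k_1,k_2,k_3\in\mathbb{Z}_{\ge0}$ and let $(P,Q,R)$ be a $(k_1,k_2,k_3)$-CGC triple associated with the non-labeled cluster $(a,b,c)$, and assume $|b|>\max\{|a|,|c|\}$. Then there exist a unique $f\in\mathbb{Z}[x_1^{\pm1},x_2^{\pm1},x_3^{\pm1}]$, a unique $\sigma\in\mathfrak{S}_3$ and a unique vertex $v$ of $\mathrm{CGC}\mathbb{T}(k_1,k_2,k_3,\sigma,f)$ such that $v=(P,Q,R)$.
   Context: Fix $k_1,k_2,k_3\in\mathbb{Z}_{\ge0}$, indeterminates $x_1,x_2,x_3$, and write $\mathbb{Z}[x^{\pm}]=\mathbb{Z}[x_1^{\pm1},x_2^{\pm1},x_3^{\pm1}]$. Mutations: $\mu_1(a,b,c)=(\frac{b^2+k_1bc+c^2}{a},b,c)$, $\mu_2(a,b,c)=(a,\frac{a^2+k_2ac+c^2}{b},c)$, $\mu_3(a,b,c)=(a,b,\frac{a^2+k_3ab+b^2}{c})$. Labeled clusters of $\mathcal{A}(k_1,k_2,k_3)$: triples obtained from $(x_1,x_2,x_3)$ by finitely many mutations; non-labeled clusters: permutations of labeled clusters; cluster variables: entries of labeled clusters. A cluster variable $y$ occurs in a unique position $i$ among labeled clusters, and its parity is $k_y:=k_i$. For a Laurent polynomial $a$, $|a|$ is its value at $x_1=x_2=x_3=1$. $\mathscr{M}=\frac{x_1^2+x_2^2+x_3^2+k_1x_2x_3+k_2x_1x_3+k_3x_1x_2}{x_1x_2x_3}$. For a $2\times 2$ matrix $P=(p_{ij})$,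 $S_P=\begin{bmatrix}\mathscr{M}p_{12}-\mathrm{tr}P&0\\(\mathscr{M}p_{12}-\mathrm{tr}P)\mathscr{M}&\mathscr{M}p_{12}-\mathrm{tr}P\end{bmatrix}$. A CGC matrix is $P\in SL(2,\mathbb{Z}[x^\pm])$ with $p_{12}$ a cluster variable and $\mathrm{tr}P=\mathscr{M}p_{12}-k_{p_{12}}$; a CGC triple is a triple $(P,Q,R)$ of CGC matrices with $Q=PR-S_Q$ and $(p_{12},q_{12},r_{12})$ a non-labeled cluster (the triple is associated with it). For $\sigma\in\mathfrak{S}_3$ and $f\in\mathbb{Z}[x^\pm]$ write $y_i=x_{\sigma(i)}$, $\kappa_i=k_{\sigma(i)}$ and define (the $(2,1)$-entries $*$ being determined by determinant $1$): $P_\sigma(f)=\begin{bmatrix}f&y_1\\ *&\frac{-fy_2y_3+\kappa_2y_1y_3+\kappa_3y_1y_2+y_1^2+y_2^2+y_3^2}{y_2y_3}\end{bmatrix}$, $Q_\sigma(f)=\begin{bmatrix}\frac{fy_2+\kappa_1y_2+y_3}{y_1}&y_2\\ *&\frac{-fy_2y_3+\kappa_3y_1y_2+y_1^2+y_2^2}{y_1y_3}\end{bmatrix}$, $R_\sigma(f)=\begin{bmatrix}\frac{fy_2y_3+\kappa_1y_2y_3+\kappa_2y_1y_3+y_1^2+y_3^2}{y_1y_2}&y_3\\ *&\frac{-fy_2y_3+y_2^2}{y_1y_2}\end{bmatrix}$. The cluster generalized Cohn tree $\mathrm{CGC}\mathbb{T}(k_1,k_2,k_3,\sigma,f)$ is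 the rooted planar binary tree whose root is $(P_\tau(f),\,P_\tau(f)Q_\tau(f)-S_{R_\tau(f)},\,Q_\tau(f))$ with $\tau=\sigma\circ(2\ 3)$ (permutations composed right to left), and in which each vertex $(P,Q,R)$ has left child $(P,PQ-S_R,Q)$ and right child $(Q,QR-S_P,R)$. *)

theory Defs
  imports "HOL-Analysis.Analysis" "HOL-Computational_Algebra.Polynomial_Factorial"
begin

text \<open>
  The ambient field is \<open>\<rat>(x\<^sub>1, x\<^sub>2, x\<^sub>3)\<close>, as the fraction field of \<open>\<int>[x\<^sub>3][x\<^sub>2][x\<^sub>1]\<close>
  (the outermost polynomial variable is \<open>x\<^sub>1\<close>). Indices live in the three-element type
  \<open>3\<close>, whose arithmetic is cyclic: \<open>i + 1\<close> and \<open>i + 2\<close> are the two indices other than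
  \<open>i\<close>. The parameters \<open>(k\<^sub>1, k\<^sub>2, k\<^sub>3)\<close> are a function \<open>k :: 3 \<Rightarrow> nat\<close>.
\<close>

type_synonym ratfun = "int poly poly poly fract"

definition var :: "3 \<Rightarrow> ratfun" where
  "var i = (if i = 1 then to_fract [:0, 1:]
            else if i = 2 then to_fract [:[:0, 1:]:]
            else to_fract [:[:[:0, 1:]:]:])"

text \<open>The Laurent polynomial ring, as the localization of the polynomial ring at \<open>x\<^sub>1x\<^sub>2x\<^sub>3\<close>.\<close>

definition laurent :: "ratfun set" where
  "laurent = {to_fract p / (var 1 * var 2 * var 3) ^ n | p n. True}"

text \<open>
  \<open>val1 a\<close> is the value \<open>|a|\<close> of the Laurent polynomial \<open>a\<close> at \<open>x\<^sub>1 = x\<^sub>2 = x\<^sub>3 = 1\<close>; the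
  denominator \<open>(x\<^sub>1x\<^sub>2x\<^sub>3)\<^sup>n\<close> has value 1 there. It is unspecified outside \<open>laurent\<close>.
\<close>

definition val1 :: "ratfun \<Rightarrow> int" where
  "val1 a = (THE v. \<exists>p n. a = to_fract p / (var 1 * var 2 * var 3) ^ n
                          \<and> v = poly (poly (poly p 1) 1) 1)"

definition mutate :: "(3 \<Rightarrow> nat) \<Rightarrow> 3 \<Rightarrow> (3 \<Rightarrow> ratfun) \<Rightarrow> (3 \<Rightarrow> ratfun)" where
  "mutate k i c = c(i := (c (i + 1) ^ 2 + of_nat (k i) * c (i + 1) * c (i + 2) + c (i + 2) ^ 2) / c i)"

inductive labeled_cluster :: "(3 \<Rightarrow> nat) \<Rightarrow> (3 \<Rightarrow> ratfun) \<Rightarrow> bool" for k where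
  initial: "labeled_cluster k var"
| mutation: "labeled_cluster k c \<Longrightarrow> labeled_cluster k (mutate k i c)"

definition nonlabeled_cluster :: "(3 \<Rightarrow> nat) \<Rightarrow> ratfun \<times> ratfun \<times> ratfun \<Rightarrow> bool" where
  "nonlabeled_cluster k t \<longleftrightarrow>
     (\<exists>c (\<pi> :: 3 \<Rightarrow> 3). labeled_cluster k c \<and> bij \<pi> \<and> t = (c (\<pi> 1), c (\<pi> 2), c (\<pi> 3)))"

definition cluster_variable :: "(3 \<Rightarrow> nat) \<Rightarrow> ratfun \<Rightarrow> bool" where
  "cluster_variable k y \<longleftrightarrow> (\<exists>c i. labeled_cluster k c \<and> y = c i)"

text \<open>The position of a cluster variable among the labeled clusters is unique.\<close>

definition parity :: "(3 \<Rightarrow> nat) \<Rightarrow> ratfun \<Rightarrow> nat" where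
  "parity k y = k (THE i. \<exists>c. labeled_cluster k c \<and> y = c i)"

definition Mconst :: "(3 \<Rightarrow> nat) \<Rightarrow> ratfun" where
  "Mconst k =
     (var 1 ^ 2 + var 2 ^ 2 + var 3 ^ 2
      + of_nat (k 1) * var 2 * var 3 + of_nat (k 2) * var 1 * var 3 + of_nat (k 3) * var 1 * var 2)
     / (var 1 * var 2 * var 3)"

type_synonym mat = "ratfun ^ 2 ^ 2"
type_synonym triple = "mat \<times> mat \<times> mat"

definition mat2 :: "ratfun \<Rightarrow> ratfun \<Rightarrow> ratfun \<Rightarrow> ratfun \<Rightarrow> mat" where
  "mat2 p11 p12 p21 p22 = vector [vector [p11, p12], vector [p21, p22]]"

definition Smat :: "(3 \<Rightarrow> nat) \<Rightarrow> mat \<Rightarrow> mat" where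
  "Smat k P =
     mat2 (Mconst k * P $ 1 $ 2 - trace P) 0
          ((Mconst k * P $ 1 $ 2 - trace P) * Mconst k) (Mconst k * P $ 1 $ 2 - trace P)"

definition SL2_laurent :: "mat set" where
  "SL2_laurent = {P. (\<forall>i j. P $ i $ j \<in> laurent) \<and> det P = 1}"

definition cgc_matrix :: "(3 \<Rightarrow> nat) \<Rightarrow> mat \<Rightarrow> bool" where
  "cgc_matrix k P \<longleftrightarrow>
     P \<in> SL2_laurent \<and> cluster_variable k (P $ 1 $ 2) \<and>
     trace P = Mconst k * P $ 1 $ 2 - of_nat (parity k (P $ 1 $ 2))"

fun associated_cluster :: "triple \<Rightarrow> ratfun \<times> ratfun \<times> ratfun" where
  "associated_cluster (P, Q, R) = (P $ 1 $ 2, Q $ 1 $ 2, R $ 1 $ 2)"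

fun cgc_triple :: "(3 \<Rightarrow> nat) \<Rightarrow> triple \<Rightarrow> bool" where
  "cgc_triple k (P, Q, R) \<longleftrightarrow>
     cgc_matrix k P \<and> cgc_matrix k Q \<and> cgc_matrix k R \<and>
     Q = P ** R - Smat k Q \<and>
     nonlabeled_cluster k (associated_cluster (P, Q, R))"

text \<open>The matrix of determinant 1 with the given entries other than the \<open>(2,1)\<close>-entry.\<close>

definition complete_SL2 :: "ratfun \<Rightarrow> ratfun \<Rightarrow> ratfun \<Rightarrow> mat" where
  "complete_SL2 p11 p12 p22 = mat2 p11 p12 ((p11 * p22 - 1) / p12) p22"

definition Pmat :: "(3 \<Rightarrow> nat) \<Rightarrow> (3 \<Rightarrow> 3) \<Rightarrow> ratfun \<Rightarrow> mat" where
  "Pmat k \<sigma> f =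
     (let y1 = var (\<sigma> 1); y2 = var (\<sigma> 2); y3 = var (\<sigma> 3);
          \<kappa>2 = of_nat (k (\<sigma> 2)); \<kappa>3 = of_nat (k (\<sigma> 3))
      in complete_SL2 f y1
           ((- f * y2 * y3 + \<kappa>2 * y1 * y3 + \<kappa>3 * y1 * y2 + y1 ^ 2 + y2 ^ 2 + y3 ^ 2) / (y2 * y3)))"

definition Qmat :: "(3 \<Rightarrow> nat) \<Rightarrow> (3 \<Rightarrow> 3) \<Rightarrow> ratfun \<Rightarrow> mat" where
  "Qmat k \<sigma> f =
     (let y1 = var (\<sigma> 1); y2 = var (\<sigma> 2); y3 = var (\<sigma> 3);
          \<kappa>1 = of_nat (k (\<sigma> 1)); \<kappa>3 = of_nat (k (\<sigma> 3))
      in complete_SL2 ((f * y2 + \<kappa>1 * y2 + y3) / y1) y2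
           ((- f * y2 * y3 + \<kappa>3 * y1 * y2 + y1 ^ 2 + y2 ^ 2) / (y1 * y3)))"

definition Rmat :: "(3 \<Rightarrow> nat) \<Rightarrow> (3 \<Rightarrow> 3) \<Rightarrow> ratfun \<Rightarrow> mat" where
  "Rmat k \<sigma> f =
     (let y1 = var (\<sigma> 1); y2 = var (\<sigma> 2); y3 = var (\<sigma> 3);
          \<kappa>1 = of_nat (k (\<sigma> 1)); \<kappa>2 = of_nat (k (\<sigma> 2))
      in complete_SL2
           ((f * y2 * y3 + \<kappa>1 * y2 * y3 + \<kappa>2 * y1 * y3 + y1 ^ 2 + y3 ^ 2) / (y1 * y2)) y3
           ((- f * y2 * y3 + y2 ^ 2) / (y1 * y2)))"

datatype branch = Left | Right

fun child :: "(3 \<Rightarrow> nat) \<Rightarrow> branch \<Rightarrow> triple \<Rightarrow> triple" where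
  "child k Left (P, Q, R) = (P, P ** Q - Smat k R, Q)"
| "child k Right (P, Q, R) = (Q, Q ** R - Smat k P, R)"

definition cgct_root :: "(3 \<Rightarrow> nat) \<Rightarrow> (3 \<Rightarrow> 3) \<Rightarrow> ratfun \<Rightarrow> triple" where
  "cgct_root k \<sigma> f =
     (let \<tau> = \<sigma> \<circ> Transposition.transpose 2 3
      in (Pmat k \<tau> f, Pmat k \<tau> f ** Qmat k \<tau> f - Smat k (Rmat k \<tau> f), Qmat k \<tau> f))"

text \<open>
  The tree is a labeling of the infinite planar binary tree, whose vertices are the finite words
  over \<open>branch\<close>, the word being the path from the root to the vertex. Thus \<open>cgct k \<sigma> f v\<close> is the
  triple at the vertex \<open>v\<close>.
\<close>

definition cgct :: "(3 \<Rightarrow> nat) \<Rightarrow> (3 \<Rightarrow> 3) \<Rightarrow> ratfun \<Rightarrow> branch list \<Rightarrow> triple" where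
  "cgct k \<sigma> f v = fold (child k) v (cgct_root k \<sigma> f)"

end

theory Submission
  imports Defs
begin

text \<open>
  Mutating a cluster at a position other than that of its largest value at 1 creates a new strict
  maximum there, so every non-initial labeled cluster arises from a reduced mutation word that can be
  read off by descent on values. A triple determines its neighbours through \<open>Q = PR - S\<^sub>Q\<close>, and the
  traces of the neighbours follow from Vieta's relation between the two roots of the Markov-type
  equation; hence the descent lifts to CGC triples and ends at the root of exactly one tree. For the
  parity of a cluster variable to be meaningful, its position must be determined: modulo 2, the degrees
  of a cluster variable agree with those of the initial variable at the same position.
\<close>

text \<open>Clusters are not shown to consist of Laurent polynomials. Values at 1 are therefore
  taken of arbitrary fractions, and only the three entries in the theorem, Laurent by hypothesis,
  connect these values with \<open>val1\<close>. The strict inequality excludes the initial cluster,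
  where all values are 1; accordingly a tree begins one mutation away from it. Over a fixed ordered
  cluster a triple has a single free parameter: a CGC matrix with known (1,2)-entry is determined by
  one diagonal entry, and the relation \<open>Q = PR - S\<^sub>Q\<close> ties \<open>R\<close> to
  \<open>P\<close>. At the root this parameter is the (1,1)-entry of the first matrix, and this is
  \<open>f\<close>. Steps towards the root divide only by matrices of determinant 1, so adjugates
  suffice and \<open>f\<close> stays in the Laurent ring.\<close>

lemma index3_numeral [simp]: "(4::3) = 1" "(5::3) = 2"
  by simp_all

lemma index3_neq [simp]: "(1::3) \<noteq> 2" "(2::3) \<noteq> 3" "(1::3) \<noteq> 3" "(2::3) \<noteq> 1" "(3::3) \<noteq> 2" "(3::3) \<noteq> 1"
  by simp_all

lemma index3_distinct_cases:
  fixes i j l :: 3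
  assumes "i \<noteq> j" "j \<noteq> l" "i \<noteq> l"
  shows "(i, j, l) \<in> {(1, 2, 3), (1, 3, 2), (2, 1, 3), (2, 3, 1), (3, 1, 2), (3, 2, 1)}"
  using assms exhaust_3[of i] exhaust_3[of j] exhaust_3[of l] by auto

lemma bij_index3_neq:
  fixes \<pi> :: "3 \<Rightarrow> 3"
  assumes "bij \<pi>"
  shows "\<pi> 1 \<noteq> \<pi> 2" "\<pi> 2 \<noteq> \<pi> 3" "\<pi> 1 \<noteq> \<pi> 3"
  using assms by (auto simp: bij_def inj_eq)

section \<open>Positions of cluster variables\<close>

text \<open>The exchange polynomial, over any semiring, so that the same expression serves for
  polynomials, fractions and rational values.\<close>

definition quad :: "nat \<Rightarrow> 'a::comm_semiring_1 \<Rightarrow> 'a \<Rightarrow> 'a" where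
  "quad k a b = a\<^sup>2 + of_nat k * a * b + b\<^sup>2"

lemma to_fract_of_nat: "to_fract (of_nat n) = of_nat n"
  by (induction n) (simp_all add: add.commute)

lemma to_fract_power: "to_fract (x ^ n) = to_fract x ^ n"
  by (induction n) simp_all

text \<open>Denominators are cleared without cancelling. The resulting shape, an exchange polynomial
  times \<open>q\<close> over a square times \<open>p\<close>, serves both degrees and
  values.\<close>

lemma quad_divide_fract:
  fixes a b c d p q :: "'a::idom"
  assumes "b \<noteq> 0" "d \<noteq> 0" "p \<noteq> 0" "q \<noteq> 0"
  shows "quad k (to_fract a / to_fract b) (to_fract c / to_fract d) / (to_fract p / to_fract q)
    = to_fract (quad k (a * d) (c * b) * q) / to_fract ((b * d)\<^sup>2 * p)"
  using assms unfolding quad_def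
  by (simp add: to_fract_of_nat divide_simps) (simp add: algebra_simps power2_eq_square)

lemma quad_pos:
  fixes a b :: "'a::linordered_idom"
  assumes "0 \<le> a" "0 \<le> b" "a \<noteq> 0 \<or> b \<noteq> 0"
  shows "0 < quad k a b"
proof -
  have "0 \<le> a\<^sup>2" "0 \<le> b\<^sup>2" "0 \<le> of_nat k * a * b" "0 < a\<^sup>2 \<or> 0 < b\<^sup>2"
    using assms by auto
  then show ?thesis
    unfolding quad_def by (meson add_nonneg_nonneg add_nonneg_pos add_pos_nonneg)
qed

text \<open>Through the nested rings this makes positivity the sign of an iterated leading
  coefficient, which prevents top terms from cancelling.\<close>

lemma poly_pos_iff_lead_coeff: "0 < p \<longleftrightarrow> 0 < lead_coeff p"
  for p :: "'a::linordered_idom poly"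
  by (simp add: less_poly_def pos_poly_def)

lemma poly_nonneg_coeff:
  fixes p :: "'a::linordered_idom poly"
  assumes "0 \<le> p" "degree p \<le> n"
  shows "0 \<le> coeff p n"
proof (cases "degree p = n")
  case True
  then show ?thesis
    using assms(1) poly_pos_iff_lead_coeff[of p] by (auto simp: le_less)
next
  case False
  then show ?thesis
    using assms(2) by (simp add: coeff_eq_0)
qed

lemma coeff_mult_le_degree_sum:
  fixes p q :: "'a::comm_semiring_0 poly"
  assumes "degree p \<le> m" "degree q \<le> n"
  shows "coeff (p * q) (m + n) = coeff p m * coeff q n"
proof (cases "degree p = m \<and> degree q = n")
  case True
  then show ?thesis
    using coeff_mult_degree_sum[of p q] by auto
next
  case False
  then have "degree (p * q) < m + n" "coeff p m = 0 \<or> coeff q n = 0"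
    using assms degree_mult_le[of p q] by (auto simp: coeff_eq_0)
  then show ?thesis
    by (auto simp: coeff_eq_0)
qed

text \<open>Positivity rules out cancellation, so the quadratic exchange polynomials have even degree
  in every variable.\<close>

lemma quad_degree_lead_coeff:
  fixes p q :: "'a::linordered_idom poly"
  assumes "0 \<le> p" "0 \<le> q" "p \<noteq> 0 \<or> q \<noteq> 0"
  obtains a b where "0 \<le> a" "0 \<le> b" "a \<noteq> 0 \<or> b \<noteq> 0"
    "even (degree (quad k p q))" "lead_coeff (quad k p q) = quad k a b"
proof -
  define n where "n = max (degree p) (degree q)"
  define a b where "a = coeff p n" and "b = coeff q n"
  have le: "degree p \<le> n" "degree q \<le> n"
    by (auto simp: n_def)
  have nonneg: "0 \<le> a" "0 \<le> b"
    using assms le by (auto simp: a_def b_def intro: poly_nonneg_coeff)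
  \<comment> \<open>If both coefficients vanish, the polynomial attaining the larger degree is zero;
    then \<open>n\<close> is 0 and the other polynomial is zero as well.\<close>
  have nz: "a \<noteq> 0 \<or> b \<noteq> 0"
  proof (rule ccontr)
    assume "\<not> (a \<noteq> 0 \<or> b \<noteq> 0)"
    then have "p = 0 \<or> q = 0" "coeff p n = 0" "coeff q n = 0"
      by (auto simp: a_def b_def n_def max_def split: if_splits)
    with assms(3) show False
      by (auto simp: n_def)
  qed
  have top: "coeff (quad k p q) (n + n) = quad k a b"
    unfolding quad_def a_def b_def power2_eq_square mult.assoc
    by (simp add: coeff_mult_le_degree_sum le of_nat_poly)
  have "degree (quad k p q) \<le> n + n"
    unfolding quad_def power2_eq_square mult.assoc of_nat_poly
    using le degree_mult_le[of p q] degree_mult_le[of p p] degree_mult_le[of q q]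
    by (intro degree_add_le) (auto intro: order_trans[OF degree_smult_le])
  moreover have "n + n \<le> degree (quad k p q)"
    using top quad_pos[OF nonneg nz, of k] by (intro le_degree) simp
  ultimately have "degree (quad k p q) = n + n"
    by simp
  then show ?thesis
    using that[OF nonneg nz] top by simp
qed

text \<open>\<open>e1\<close> and \<open>e2\<close> say whether the degree in \<open>x\<^sub>1\<close>, respectively that of the leading coefficient
  in \<open>x\<^sub>2\<close>, is even; two variables suffice to separate three positions.\<close>

definition has_degree_parity :: "ratfun \<Rightarrow> bool \<Rightarrow> bool \<Rightarrow> bool" where
  "has_degree_parity r e1 e2 \<longleftrightarrow> (\<exists>p q. 0 < p \<and> 0 < q \<and> r = to_fract p / to_fract q \<and>
     even (degree p + degree q) = e1 \<and> even (degree (lead_coeff p) + degree (lead_coeff q)) = e2)"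

text \<open>Cross-multiplication gives an equality of products, and degrees add over an integral
  domain. Writing a degree difference as a sum does not change its parity.\<close>

lemma has_degree_parity_unique:
  assumes "has_degree_parity r e1 e2" "has_degree_parity r e1' e2'"
  shows "e1 = e1'" "e2 = e2'"
proof -
  obtain p q where pq: "0 < p" "0 < q" "r = to_fract p / to_fract q"
      "even (degree p + degree q) = e1" "even (degree (lead_coeff p) + degree (lead_coeff q)) = e2"
    using assms(1) unfolding has_degree_parity_def by blast
  obtain p' q' where pq': "0 < p'" "0 < q'" "r = to_fract p' / to_fract q'"
      "even (degree p' + degree q') = e1'" "even (degree (lead_coeff p') + degree (lead_coeff q')) = e2'"
    using assms(2) unfolding has_degree_parity_def by blast
  have nz: "p \<noteq> 0" "q \<noteq> 0" "p' \<noteq> 0" "q' \<noteq> 0"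
    using pq pq' by auto
  then have "to_fract (p * q') = to_fract (p' * q)"
    using pq(3) pq'(3) by (simp add: frac_eq_eq)
  then have eq: "p * q' = p' * q"
    by (simp only: to_fract_eq_iff)
  have "degree p + degree q' = degree p' + degree q"
    using arg_cong[OF eq, of degree] nz by (simp add: degree_mult_eq)
  moreover have "degree (lead_coeff p) + degree (lead_coeff q') = degree (lead_coeff p') + degree (lead_coeff q)"
    using arg_cong[OF eq, of "\<lambda>x. degree (lead_coeff x)"] nz
    by (simp only: lead_coeff_mult) (simp add: degree_mult_eq)
  ultimately have "even (degree p + degree q) = even (degree p' + degree q')"
      "even (degree (lead_coeff p) + degree (lead_coeff q)) = even (degree (lead_coeff p') + degree (lead_coeff q'))"
    by presburger+
  then show "e1 = e1'" "e2 = e2'"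
    using pq(4,5) pq'(4,5) by simp_all
qed

text \<open>The exchange polynomial and the squared denominators contribute even degrees, so modulo
  2 the quotient behaves like the inverse of \<open>r\<close>, hence like \<open>r\<close>.\<close>

lemma has_degree_parity_exchange:
  assumes "has_degree_parity r e1 e2" "has_degree_parity s d1 d2" "has_degree_parity t d1' d2'"
  shows "has_degree_parity (quad k s t / r) e1 e2"
proof -
  obtain p q where pq: "0 < p" "0 < q" "r = to_fract p / to_fract q"
      "even (degree p + degree q) = e1" "even (degree (lead_coeff p) + degree (lead_coeff q)) = e2"
    using assms(1) unfolding has_degree_parity_def by blast
  obtain a b where ab: "0 < a" "0 < b" "s = to_fract a / to_fract b"
    using assms(2) unfolding has_degree_parity_def by blast
  obtain c d where cd: "0 < c" "0 < d" "t = to_fract c / to_fract d"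
    using assms(3) unfolding has_degree_parity_def by blast
  let ?N = "quad k (a * d) (c * b)"
  have Npos: "0 < ?N"
    using ab cd by (intro quad_pos) (auto intro: less_imp_le)
  obtain u v where uv: "0 \<le> u" "0 \<le> v" "u \<noteq> 0 \<or> v \<noteq> 0" "even (degree ?N)" "lead_coeff ?N = quad k u v"
    using quad_degree_lead_coeff[of "a * d" "c * b" k] ab cd by (auto simp: less_imp_le)
  \<comment> \<open>The leading coefficient of an exchange polynomial is again one, so the
    even-degree argument applies a second time, now in \<open>x\<^sub>2\<close>.\<close>
  have ev: "even (degree (lead_coeff ?N))"
    using quad_degree_lead_coeff[OF uv(1-3), of k] uv(5) by metis
  have nz: "p \<noteq> 0" "q \<noteq> 0" "b \<noteq> 0" "d \<noteq> 0" "?N \<noteq> 0"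
    using pq ab cd Npos by auto
  have "quad k s t / r = to_fract (?N * q) / to_fract ((b * d)\<^sup>2 * p)"
    unfolding ab(3) cd(3) pq(3) using nz by (simp only: quad_divide_fract not_False_eq_True)
  moreover have "even (degree (?N * q) + degree ((b * d)\<^sup>2 * p)) = e1"
    using nz uv(4) pq(4) by (auto simp: degree_mult_eq degree_power_eq)
  moreover have "even (degree (lead_coeff (?N * q)) + degree (lead_coeff ((b * d)\<^sup>2 * p))) = e2"
    using nz ev pq(5) unfolding lead_coeff_mult lead_coeff_power by (auto simp: degree_mult_eq degree_power_eq)
  moreover have "0 < ?N * q" "0 < (b * d)\<^sup>2 * p"
    using Npos pq nz by simp_all
  ultimately show ?thesis
    unfolding has_degree_parity_def by blast
qed

lemma mutate_neq [simp]: "j \<noteq> i \<Longrightarrow> mutate k i c j = c j"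
  by (simp add: mutate_def)

lemma mutate_eq:
  assumes "i \<noteq> j" "j \<noteq> l" "i \<noteq> l"
  shows "mutate k i c i = quad (k i) (c j) (c l) / c i"
  using index3_distinct_cases[OF assms] by (auto simp: mutate_def quad_def algebra_simps)

lemma labeled_cluster_degree_parity:
  assumes "labeled_cluster k c"
  shows "has_degree_parity (c i) (i \<noteq> 1) (i \<noteq> 2)"
  using assms
proof (induction arbitrary: i rule: labeled_cluster.induct)
  case initial
  let ?x = "if i = 1 then [:0, 1:] else if i = 2 then [:[:0, 1:]:] else [:[:[:0, 1:]:]:] :: int poly poly poly"
  have "0 < ?x" "0 < (1 :: int poly poly poly)" "var i = to_fract ?x / to_fract 1"
      "even (degree ?x + degree (1 :: int poly poly poly)) = (i \<noteq> 1)"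
      "even (degree (lead_coeff ?x) + degree (lead_coeff (1 :: int poly poly poly))) = (i \<noteq> 2)"
    using exhaust_3[of i] by (auto simp: var_def poly_pos_iff_lead_coeff)
  then show ?case
    unfolding has_degree_parity_def by blast
next
  case (mutation c j)
  show ?case
  proof (cases "i = j")
    case True
    have "mutate k i c i = quad (k i) (c (i + 1)) (c (i + 2)) / c i"
      by (simp add: mutate_def quad_def)
    with True show ?thesis
      using has_degree_parity_exchange mutation.IH by metis
  next
    case False
    then show ?thesis
      using mutation.IH by simp
  qed
qed

text \<open>Mutation preserves the parity pair at each position, and the pairs of the three initial
  variables are different.\<close>

lemma cluster_position_unique:
  assumes "labeled_cluster k c" "labeled_cluster k c'" "c i = c' j"
  shows "i = j"
proof -
  have "has_degree_parity (c i) (j \<noteq> 1) (j \<noteq> 2)"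
    using labeled_cluster_degree_parity[OF assms(2), of j] assms(3) by simp
  note has_degree_parity_unique[OF labeled_cluster_degree_parity[OF assms(1), of i] this]
  then show ?thesis
    using exhaust_3[of i] exhaust_3[of j] by auto
qed

lemma parity_cluster_variable:
  assumes "labeled_cluster k c"
  shows "parity k (c i) = k i"
proof -
  have "(THE j. \<exists>d. labeled_cluster k d \<and> c i = d j) = i"
    using assms cluster_position_unique by (intro the_equality) blast+
  then show ?thesis
    by (simp add: parity_def)
qed

section \<open>Values of clusters at one\<close>

definition ev1 :: "int poly poly poly \<Rightarrow> int" where
  "ev1 p = poly (poly (poly p 1) 1) 1"

text \<open>A relation that accepts any representation whose denominator survives at 1, hence
  applicable to cluster variables whose form is unknown.\<close>

definition has_value :: "ratfun \<Rightarrow> rat \<Rightarrow> bool" where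
  "has_value r v \<longleftrightarrow> (\<exists>p q. r = to_fract p / to_fract q \<and> ev1 q \<noteq> 0 \<and> v = of_int (ev1 p) / of_int (ev1 q))"

lemma ev1_simps [simp]:
  "ev1 (p + q) = ev1 p + ev1 q" "ev1 (p * q) = ev1 p * ev1 q" "ev1 (p ^ n) = ev1 p ^ n"
  "ev1 0 = 0" "ev1 1 = 1" "ev1 (of_nat n) = of_nat n"
  by (simp_all add: ev1_def)

lemma has_value_unique:
  assumes "has_value r v" "has_value r w"
  shows "v = w"
proof -
  obtain p q where pq: "r = to_fract p / to_fract q" "ev1 q \<noteq> 0" "v = of_int (ev1 p) / of_int (ev1 q)"
    using assms(1) unfolding has_value_def by blast
  obtain p' q' where pq': "r = to_fract p' / to_fract q'" "ev1 q' \<noteq> 0" "w = of_int (ev1 p') / of_int (ev1 q')"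
    using assms(2) unfolding has_value_def by blast
  have nz: "q \<noteq> 0" "q' \<noteq> 0"
    using pq pq' by auto
  then have "to_fract (p * q') = to_fract (p' * q)"
    using pq(1) pq'(1) by (simp add: frac_eq_eq)
  then have "p * q' = p' * q"
    by (simp only: to_fract_eq_iff)
  then have "ev1 p * ev1 q' = ev1 p' * ev1 q"
    by (metis ev1_simps(2))
  then have "(of_int (ev1 p) :: rat) * of_int (ev1 q') = of_int (ev1 p') * of_int (ev1 q)"
    by (metis of_int_mult)
  then show ?thesis
    using pq pq' by (simp add: frac_eq_eq)
qed

lemma has_value_var: "has_value (var i) 1"
proof -
  let ?x = "if i = 1 then [:0, 1:] else if i = 2 then [:[:0, 1:]:] else [:[:[:0, 1:]:]:] :: int poly poly poly"
  have "var i = to_fract ?x / to_fract 1" "ev1 ?x = 1"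
    by (auto simp: var_def ev1_def)
  then show ?thesis
    unfolding has_value_def by (intro exI[of _ ?x] exI[of _ 1]) simp
qed

lemma has_value_quad_divide:
  assumes "has_value r u" "has_value s v" "has_value t w" "u \<noteq> 0"
  shows "has_value (quad k s t / r) (quad k v w / u)"
proof -
  obtain p q where pq: "r = to_fract p / to_fract q" "ev1 q \<noteq> 0" "u = of_int (ev1 p) / of_int (ev1 q)"
    using assms(1) unfolding has_value_def by blast
  obtain a b where ab: "s = to_fract a / to_fract b" "ev1 b \<noteq> 0" "v = of_int (ev1 a) / of_int (ev1 b)"
    using assms(2) unfolding has_value_def by blast
  obtain c d where cd: "t = to_fract c / to_fract d" "ev1 d \<noteq> 0" "w = of_int (ev1 c) / of_int (ev1 d)"
    using assms(3) unfolding has_value_def by blast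
  let ?N = "quad k (a * d) (c * b)"
  have p: "ev1 p \<noteq> 0"
    using assms(4) pq(3) by auto
  have nz: "p \<noteq> 0" "q \<noteq> 0" "b \<noteq> 0" "d \<noteq> 0"
    using p pq ab cd by auto
  have "quad k s t / r = to_fract (?N * q) / to_fract ((b * d)\<^sup>2 * p)"
    unfolding ab(1) cd(1) pq(1) using nz by (simp only: quad_divide_fract not_False_eq_True)
  moreover have "ev1 ((b * d)\<^sup>2 * p) \<noteq> 0"
    using p pq ab cd by simp
  moreover have "quad k v w / u = of_int (ev1 (?N * q)) / of_int (ev1 ((b * d)\<^sup>2 * p))"
    using p pq(2) ab(2) cd(2) unfolding ab(3) cd(3) pq(3) quad_def
    by (simp add: divide_simps) (simp add: algebra_simps power2_eq_square)
  ultimately show ?thesis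
    unfolding has_value_def by blast
qed

lemma var_nonzero [simp]: "var i \<noteq> 0"
  by (simp add: var_def)

text \<open>The bridge from \<open>val1\<close> in the theorem to the relational values: a power of
  the product of the variables is a denominator of value 1.\<close>

lemma has_value_val1:
  assumes "r \<in> laurent"
  shows "has_value r (of_int (val1 r))"
proof -
  have val: "has_value r (of_int (ev1 p))" if "r = to_fract p / (var 1 * var 2 * var 3) ^ n" for p n
  proof -
    let ?q = "([:0, 1:] * [:[:0, 1:]:] * [:[:[:0, 1:]:]:]) ^ n :: int poly poly poly"
    have "(var 1 * var 2 * var 3) ^ n = to_fract ?q"
      by (simp only: to_fract_mult to_fract_power) (simp add: var_def)
    moreover have "ev1 ?q = 1"
      by (simp only: ev1_simps) (simp add: ev1_def)
    ultimately show ?thesis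
      unfolding has_value_def that by (intro exI[of _ p] exI[of _ ?q]) simp
  qed
  obtain p n where pn: "r = to_fract p / (var 1 * var 2 * var 3) ^ n"
    using assms unfolding laurent_def by blast
  have "val1 r = ev1 p"
    unfolding val1_def ev1_def[symmetric]
    using pn val has_value_unique by (intro the_equality) (blast, metis of_int_eq_iff)
  then show ?thesis
    using val[OF pn] by simp
qed

section \<open>Reduced mutation words and strict maxima\<close>

inductive reduced_cluster :: "(3 \<Rightarrow> nat) \<Rightarrow> (3 \<Rightarrow> ratfun) \<Rightarrow> 3 \<Rightarrow> bool" for k where
  first: "reduced_cluster k (mutate k i var) i"
| step: "reduced_cluster k c i \<Longrightarrow> j \<noteq> i \<Longrightarrow> reduced_cluster k (mutate k j c) j"

lemma reduced_cluster_labeled: "reduced_cluster k c i \<Longrightarrow> labeled_cluster k c"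
  by (induction rule: reduced_cluster.induct) (auto intro: labeled_cluster.intros)

lemma labeled_cluster_has_value:
  assumes "labeled_cluster k c"
  shows "\<exists>u>0. has_value (c i) u"
  using assms
proof (induction arbitrary: i rule: labeled_cluster.induct)
  case initial
  then show ?case
    using has_value_var zero_less_one by blast
next
  case (mutation c j)
  show ?case
  proof (cases "i = j")
    case True
    obtain u v w where "0 < u" "has_value (c i) u" "0 < v" "has_value (c (i + 1)) v" "0 < w" "has_value (c (i + 2)) w"
      using mutation.IH by blast
    then have "has_value (quad (k i) (c (i + 1)) (c (i + 2)) / c i) (quad (k i) v w / u)" "0 < quad (k i) v w / u"
      by (auto intro!: has_value_quad_divide quad_pos divide_pos_pos)
    then show ?thesis
      using True by (auto simp: mutate_def quad_def)
  next
    case False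
    then show ?thesis
      using mutation.IH by simp
  qed
qed

lemma labeled_cluster_nonzero:
  assumes "labeled_cluster k c"
  shows "c i \<noteq> 0"
proof
  assume "c i = 0"
  moreover have "has_value 0 0"
    unfolding has_value_def by (intro exI[of _ 0] exI[of _ 1]) simp
  ultimately show False
    using labeled_cluster_has_value[OF assms, of i] has_value_unique by fastforce
qed

lemma mutate_mutate:
  assumes "labeled_cluster k c"
  shows "mutate k i (mutate k i c) = c"
proof -
  have "i + 1 \<noteq> i" "i + 2 \<noteq> i"
    using exhaust_3[of i] by auto
  \<comment> \<open>The second mutation divides this numerator by its own quotient by
    \<open>c i\<close>. The mutated entry is an entry of a cluster, hence nonzero, and so is the
    numerator.\<close>
  moreover have "quad (k i) (c (i + 1)) (c (i + 2)) \<noteq> 0"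
    using labeled_cluster_nonzero[OF labeled_cluster.mutation[OF assms, of i], of i]
    by (auto simp: mutate_def quad_def)
  ultimately show ?thesis
    using labeled_cluster_nonzero[OF assms, of i]
    by (auto simp: mutate_def quad_def fun_eq_iff)
qed

text \<open>Mutating again at the last position undoes the last step, so every word shortens to one
  without equal neighbours.\<close>

lemma labeled_cluster_cases_reduced:
  assumes "labeled_cluster k c"
  shows "c = var \<or> (\<exists>i. reduced_cluster k c i)"
  using assms
proof (induction rule: labeled_cluster.induct)
  case initial
  then show ?case by simp
next
  case (mutation c j)
  then consider "c = var" | "reduced_cluster k c j" | i where "reduced_cluster k c i" "i \<noteq> j"
    by blast
  then show ?case
  proof cases
    case 1
    then show ?thesis
      using reduced_cluster.first by blast
  next
    case 2
    then show ?thesis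
    proof cases
      case first
      then show ?thesis
        using mutate_mutate[OF labeled_cluster.initial] by simp
    next
      case (step c' i)
      then show ?thesis
        using mutate_mutate[OF reduced_cluster_labeled[OF step(2)]] by auto
    qed
  next
    case 3
    then show ?thesis
      using reduced_cluster.step[OF 3(1), of j] by auto
  qed
qed

lemma exchange_value_gt:
  fixes u v w :: rat
  assumes "0 < u" "u \<le> v" "0 < w" "w \<le> v"
  shows "v < quad k v w / u" "w < quad k v w / u"
proof -
  have "v * u \<le> v\<^sup>2"
    using assms by (simp add: power2_eq_square)
  moreover have "0 < w\<^sup>2" "0 \<le> of_nat k * v * w"
    using assms by auto
  ultimately have "v * u < quad k v w"
    unfolding quad_def by linarith
  then show "v < quad k v w / u"
    using assms by (simp add: less_divide_eq)
  then show "w < quad k v w / u"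
    using assms by simp
qed

lemma quad_commute: "quad k a b = quad k b a"
  by (simp add: quad_def algebra_simps)

text \<open>The next mutation avoids the position of the current maximum, so that maximum is one of
  the two unchanged entries, and the new entry exceeds it.\<close>

lemma reduced_cluster_max:
  assumes "reduced_cluster k c i" "j \<noteq> i" "has_value (c i) u" "has_value (c j) v"
  shows "v < u"
  using assms
proof (induction arbitrary: j u v rule: reduced_cluster.induct)
  case (first i)
  obtain l where l: "j \<noteq> l" "i \<noteq> l"
    using first(1) exhaust_3[of i] exhaust_3[of j] by (metis index3_neq)
  have "has_value (mutate k i var i) (quad (k i) 1 1 / 1)"
    using mutate_eq[of i j l k var] l first(1) has_value_quad_divide[OF has_value_var has_value_var has_value_var]
    by auto
  moreover have "v = 1"
    using first has_value_unique[OF has_value_var] by auto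
  ultimately show ?case
    using first(2) has_value_unique exchange_value_gt[of 1 1 1] by fastforce
next
  case (step c i m)
  obtain l where l: "j \<noteq> l" "m \<noteq> l"
    using step.prems(1) exhaust_3[of m] exhaust_3[of j] by (metis index3_neq)
  note lc = reduced_cluster_labeled[OF step.hyps(1)]
  obtain x y where x: "0 < x" "has_value (c m) x" and y: "0 < y" "has_value (c l) y"
    using labeled_cluster_has_value[OF lc] by blast
  have v: "has_value (c j) v" "0 < v"
    using step.prems labeled_cluster_has_value[OF lc, of j] has_value_unique by auto
  have "has_value (mutate k m c m) (quad (k m) v y / x)"
    using mutate_eq[of m j l k c] l step.prems(1) has_value_quad_divide[OF x(2) v(1) y(2)] x(1) by auto
  then have u: "u = quad (k m) v y / x"
    using step.prems(2) has_value_unique by blast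
  have "i = j \<or> i = l"
    using index3_distinct_cases[of m j l] exhaust_3[of i] l step.prems(1) step.hyps(2) by auto
  then show ?case
  proof
    assume "i = j"
    then have "x < v" "y < v"
      using step.IH[of m v x] step.IH[of l v y] step.hyps(2) l x y v by auto
    then show ?thesis
      unfolding u using exchange_value_gt[of x v y] x y v by simp
  next
    assume "i = l"
    then have "x < y" "v < y"
      using step.IH[of m y x] step.IH[of j y v] step.hyps(2) step.prems(1) l x y v by auto
    then show ?thesis
      unfolding u using exchange_value_gt[of x y v] x y v by (simp add: quad_commute)
  qed
qed

text \<open>The initial cluster has no strict maximum, and in any other cluster the strict maximum
  sits at the end of a reduced word, so the two positions coincide.\<close>

lemma reduced_cluster_if_max:
  assumes "labeled_cluster k c" "has_value (c i) u"
    and "\<And>j v. j \<noteq> i \<Longrightarrow> has_value (c j) v \<Longrightarrow> v < u"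
  shows "reduced_cluster k c i"
proof -
  consider "c = var" | j where "reduced_cluster k c j"
    using labeled_cluster_cases_reduced[OF assms(1)] by blast
  then show ?thesis
  proof cases
    case 1
    then have "u = 1"
      using assms(2) has_value_unique[OF _ has_value_var] by auto
    moreover have "i + 1 \<noteq> i"
      using exhaust_3[of i] by auto
    ultimately show ?thesis
      using assms(3)[of "i + 1" 1] 1 has_value_var by simp
  next
    case 2
    obtain v where "has_value (c j) v"
      using labeled_cluster_has_value[OF assms(1)] by blast
    then have "j = i"
      using reduced_cluster_max[OF 2, of i] assms(2,3) by force
    with 2 show ?thesis
      by simp
  qed
qed

text \<open>In each single entry the relation is a monic quadratic with the exchange polynomial as
  constant term, and mutation passes to the other root.\<close>

lemma labeled_cluster_markov:
  assumes "labeled_cluster k c"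
  shows "(c 1)\<^sup>2 + (c 2)\<^sup>2 + (c 3)\<^sup>2 + of_nat (k 1) * c 2 * c 3 + of_nat (k 2) * c 1 * c 3 + of_nat (k 3) * c 1 * c 2
    = Mconst k * c 1 * c 2 * c 3"
  using assms
proof (induction rule: labeled_cluster.induct)
  case initial
  then show ?case
    by (simp add: Mconst_def)
next
  case (mutation c i)
  \<comment> \<open>Two roots with product \<open>t\<close>: multiplying the polynomial at
    \<open>y\<close> by \<open>x\<^sup>2\<close> gives \<open>t\<close> times the polynomial at
    \<open>x\<close>.\<close>
  have exchange: "y\<^sup>2 + s * y + t = 0" if "x\<^sup>2 + s * x + t = 0" "x \<noteq> 0" "y = t / x" for x y s t :: ratfun
  proof -
    have "x * y = t"
      using that by simp
    then have "x\<^sup>2 * (y\<^sup>2 + s * y + t) = t * (x\<^sup>2 + s * x + t)"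
      by (auto simp: algebra_simps power2_eq_square)
    then show ?thesis
      using that by simp
  qed
  note nz = labeled_cluster_nonzero[OF mutation.hyps]
  consider "i = 1" | "i = 2" | "i = 3"
    using exhaust_3 by blast
  then show ?case
  proof cases
    case 1
    have "mutate k 1 c 1 = ((c 2)\<^sup>2 + (c 3)\<^sup>2 + of_nat (k 1) * c 2 * c 3) / c 1"
      by (simp add: mutate_def algebra_simps)
    from exchange[OF _ nz this, of "of_nat (k 2) * c 3 + of_nat (k 3) * c 2 - Mconst k * c 2 * c 3"] 1 mutation.IH
    show ?thesis
      by (simp add: algebra_simps)
  next
    case 2
    have "mutate k 2 c 2 = ((c 1)\<^sup>2 + (c 3)\<^sup>2 + of_nat (k 2) * c 1 * c 3) / c 2"
      by (simp add: mutate_def algebra_simps)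
    from exchange[OF _ nz this, of "of_nat (k 1) * c 3 + of_nat (k 3) * c 1 - Mconst k * c 1 * c 3"] 2 mutation.IH
    show ?thesis
      by (simp add: algebra_simps)
  next
    case 3
    have "mutate k 3 c 3 = ((c 1)\<^sup>2 + (c 2)\<^sup>2 + of_nat (k 3) * c 1 * c 2) / c 3"
      by (simp add: mutate_def algebra_simps)
    from exchange[OF _ nz this, of "of_nat (k 1) * c 2 + of_nat (k 2) * c 1 - Mconst k * c 1 * c 2"] 3 mutation.IH
    show ?thesis
      by (simp add: algebra_simps)
  qed
qed

lemma markov_distinct:
  assumes "labeled_cluster k c" "i \<noteq> j" "j \<noteq> l" "i \<noteq> l"
  shows "(c i)\<^sup>2 + (c j)\<^sup>2 + (c l)\<^sup>2 + of_nat (k i) * c j * c l + of_nat (k j) * c i * c l + of_nat (k l) * c i * c j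
    = Mconst k * c i * c j * c l"
  using index3_distinct_cases[OF assms(2-4)] labeled_cluster_markov[OF assms(1)]
  by (auto simp: algebra_simps)

text \<open>Using the sum of the two roots instead of their product removes the division. This is
  the form in which the (1,2)-entries of matrix products appear.\<close>

lemma mutate_vieta:
  assumes "labeled_cluster k c" "i \<noteq> j" "j \<noteq> l" "i \<noteq> l"
  shows "mutate k i c i = Mconst k * c j * c l - of_nat (k j) * c l - of_nat (k l) * c j - c i"
proof -
  have "(Mconst k * c j * c l - of_nat (k j) * c l - of_nat (k l) * c j - c i) * c i = quad (k i) (c j) (c l)"
    using markov_distinct[OF assms] unfolding quad_def power2_eq_square by algebra
  then show ?thesis
    using labeled_cluster_nonzero[OF assms(1), of i] mutate_eq[OF assms(2-4), of k c]
    by (simp add: divide_eq_eq)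
qed

section \<open>Cohn matrices\<close>

lemma mat2_nth [simp]:
  "mat2 a b c d $ 1 $ 1 = a" "mat2 a b c d $ 1 $ 2 = b" "mat2 a b c d $ 2 $ 1 = c" "mat2 a b c d $ 2 $ 2 = d"
  by (simp_all add: mat2_def)

lemma mat2_eq_iff:
  "P = Q \<longleftrightarrow> P $ 1 $ 1 = Q $ 1 $ 1 \<and> P $ 1 $ 2 = Q $ 1 $ 2 \<and> P $ 2 $ 1 = Q $ 2 $ 1 \<and> P $ 2 $ 2 = Q $ 2 $ 2"
  for P Q :: "'a^2^2"
  by (auto simp: vec_eq_iff forall_2)

lemma trace_2: "trace P = P $ 1 $ 1 + P $ 2 $ 2" for P :: "'a::comm_semiring_1^2^2"
  by (simp add: trace_def sum_2)

lemma mult_2_nth: "(P ** Q) $ i $ j = P $ i $ 1 * Q $ 1 $ j + P $ i $ 2 * Q $ 2 $ j"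
  for P Q :: "'a::comm_semiring_1^2^2"
  by (simp add: matrix_matrix_mult_def sum_2)

lemmas entries_2 = trace_2 det_2 mult_2_nth

definition adj2 :: "mat \<Rightarrow> mat" where
  "adj2 P = mat2 (P $ 2 $ 2) (- P $ 1 $ 2) (- P $ 2 $ 1) (P $ 1 $ 1)"

lemma adj2_mult:
  assumes "det P = 1"
  shows "P ** adj2 P = mat 1" "adj2 P ** P = mat 1"
  using assms by (auto simp: mat2_eq_iff entries_2 adj2_def mat_def algebra_simps)

lemma det_adj2: "det (adj2 P) = det P"
  by (simp add: adj2_def det_2 algebra_simps)

text \<open>The common value of \<open>Smat\<close> on all CGC matrices at position
  \<open>i\<close>, where \<open>Mconst k\<close> times the (1,2)-entry exceeds the trace by
  \<open>k i\<close>.\<close>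

definition Nmat :: "(3 \<Rightarrow> nat) \<Rightarrow> 3 \<Rightarrow> mat" where
  "Nmat k i = mat2 (of_nat (k i)) 0 (of_nat (k i) * Mconst k) (of_nat (k i))"

lemma Nmat_nth [simp]:
  "Nmat k i $ 1 $ 1 = of_nat (k i)" "Nmat k i $ 1 $ 2 = 0"
  "Nmat k i $ 2 $ 1 = of_nat (k i) * Mconst k" "Nmat k i $ 2 $ 2 = of_nat (k i)"
  by (simp_all add: Nmat_def)

text \<open>The parity is replaced by an explicit position, and the Laurent condition is left to be
  tracked separately.\<close>

definition cgc_at :: "(3 \<Rightarrow> nat) \<Rightarrow> 3 \<Rightarrow> ratfun \<Rightarrow> mat \<Rightarrow> bool" where
  "cgc_at k i y P \<longleftrightarrow> det P = 1 \<and> P $ 1 $ 2 = y \<and> trace P = Mconst k * y - of_nat (k i)"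

lemma cgc_at_D:
  assumes "cgc_at k i y P"
  shows "det P = 1" "P $ 1 $ 2 = y" "trace P = Mconst k * y - of_nat (k i)"
  using assms by (simp_all add: cgc_at_def)

lemma Smat_eq_Nmat:
  assumes "cgc_at k i y P"
  shows "Smat k P = Nmat k i"
  using cgc_at_D[OF assms] by (simp add: Smat_def Nmat_def)

text \<open>The trace supplies the other diagonal entry and the determinant the (2,1)-entry.\<close>

lemma cgc_at_eqI:
  assumes "cgc_at k i y P" "cgc_at k i y Q" "P $ 1 $ 1 = Q $ 1 $ 1 \<or> P $ 2 $ 2 = Q $ 2 $ 2" "y \<noteq> 0"
  shows "P = Q"
proof -
  note P = cgc_at_D[OF assms(1)] and Q = cgc_at_D[OF assms(2)]
  have diag: "P $ 1 $ 1 = Q $ 1 $ 1" "P $ 2 $ 2 = Q $ 2 $ 2"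
    using assms(3) P(3) Q(3) unfolding trace_2 by auto
  have "y * P $ 2 $ 1 = P $ 1 $ 1 * P $ 2 $ 2 - 1" "y * Q $ 2 $ 1 = Q $ 1 $ 1 * Q $ 2 $ 2 - 1"
    using P(1,2) Q(1,2) by (simp_all add: det_2 algebra_simps)
  then have "y * P $ 2 $ 1 = y * Q $ 2 $ 1"
    using diag by simp
  then show ?thesis
    using diag P(2) Q(2) assms(4) by (simp add: mat2_eq_iff)
qed

lemma det_diff_Nmat:
  "det (X - Nmat k i) = det X - of_nat (k i) * (trace X - Mconst k * X $ 1 $ 2) + (of_nat (k i))\<^sup>2"
  by (simp add: entries_2 algebra_simps power2_eq_square)

lemma det_add_Nmat:
  "det (X + Nmat k i) = det X + of_nat (k i) * (trace X - Mconst k * X $ 1 $ 2) + (of_nat (k i))\<^sup>2"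
  by (simp add: entries_2 algebra_simps power2_eq_square)

lemma trace_diff_Nmat: "trace (X - Nmat k i) = trace X - 2 * of_nat (k i)"
  by (simp add: trace_2 algebra_simps)

text \<open>Subtracting \<open>Nmat\<close> changes the trace defect from plus to minus
  \<open>k i\<close>, while the two squares of \<open>k i\<close> cancel in the determinant.\<close>

lemma cgc_at_diff_Nmat:
  assumes "det X = 1" "trace X = Mconst k * X $ 1 $ 2 + of_nat (k i)"
  shows "cgc_at k i (X $ 1 $ 2) (X - Nmat k i)"
  using assms by (simp add: cgc_at_def det_diff_Nmat trace_diff_Nmat power2_eq_square)

lemma trace_if_cgc_at_diff_Nmat:
  assumes "cgc_at k i y (X - Nmat k i)"
  shows "y = X $ 1 $ 2" "trace X = Mconst k * X $ 1 $ 2 + of_nat (k i)"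
  using cgc_at_D[OF assms] by (auto simp: trace_diff_Nmat algebra_simps)

text \<open>By Cayley-Hamilton, \<open>adj2 P\<close> is the trace of \<open>P\<close> times the
  identity minus \<open>P\<close>. So the quotient and \<open>P ** Q\<close> have Vieta-conjugate
  (1,2)-entries and opposite trace defects, and either one can be computed from the other.\<close>

lemma left_quotient:
  assumes P: "cgc_at k i p P" and Q: "cgc_at k j q Q" and R: "R = adj2 P ** (Q + Nmat k j)"
  shows "R $ 1 $ 2 = Mconst k * p * q - of_nat (k i) * q - of_nat (k j) * p - (P ** Q) $ 1 $ 2"
    and "trace R = Mconst k * R $ 1 $ 2 - (trace (P ** Q) - Mconst k * (P ** Q) $ 1 $ 2)"
    and "det R = 1"
    and "P ** R = Q + Nmat k j"
proof -
  note P = cgc_at_D[OF P] and Q = cgc_at_D[OF Q]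
  have p22: "P $ 2 $ 2 = Mconst k * p - of_nat (k i) - P $ 1 $ 1"
    using P(3) by (simp add: trace_2 algebra_simps)
  have q11: "Q $ 1 $ 1 = Mconst k * q - of_nat (k j) - Q $ 2 $ 2"
    using Q(3) by (simp add: trace_2 algebra_simps)
  show "R $ 1 $ 2 = Mconst k * p * q - of_nat (k i) * q - of_nat (k j) * p - (P ** Q) $ 1 $ 2"
    unfolding R by (simp add: mult_2_nth adj2_def P Q p22 algebra_simps)
  show "trace R = Mconst k * R $ 1 $ 2 - (trace (P ** Q) - Mconst k * (P ** Q) $ 1 $ 2)"
    unfolding R by (simp add: entries_2 adj2_def P Q p22 q11 algebra_simps)
  show "det R = 1"
    unfolding R by (simp add: det_mul det_adj2 det_add_Nmat P Q power2_eq_square)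
  show "P ** R = Q + Nmat k j"
    unfolding R by (simp add: matrix_mul_assoc adj2_mult P)
qed

lemma right_quotient:
  assumes Q: "cgc_at k j q Q" and R: "cgc_at k l r R" and P: "P = (Q + Nmat k j) ** adj2 R"
  shows "P $ 1 $ 2 = Mconst k * q * r - of_nat (k j) * r - of_nat (k l) * q - (Q ** R) $ 1 $ 2"
    and "trace P = Mconst k * P $ 1 $ 2 - (trace (Q ** R) - Mconst k * (Q ** R) $ 1 $ 2)"
    and "det P = 1"
    and "P ** R = Q + Nmat k j"
proof -
  note R = cgc_at_D[OF R] and Q = cgc_at_D[OF Q]
  have r11: "R $ 1 $ 1 = Mconst k * r - of_nat (k l) - R $ 2 $ 2"
    using R(3) by (simp add: trace_2 algebra_simps)
  have q22: "Q $ 2 $ 2 = Mconst k * q - of_nat (k j) - Q $ 1 $ 1"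
    using Q(3) by (simp add: trace_2 algebra_simps)
  show "P $ 1 $ 2 = Mconst k * q * r - of_nat (k j) * r - of_nat (k l) * q - (Q ** R) $ 1 $ 2"
    unfolding P by (simp add: mult_2_nth adj2_def Q R r11 algebra_simps)
  show "trace P = Mconst k * P $ 1 $ 2 - (trace (Q ** R) - Mconst k * (Q ** R) $ 1 $ 2)"
    unfolding P by (simp add: entries_2 adj2_def Q R r11 q22 algebra_simps)
  show "det P = 1"
    unfolding P by (simp add: det_mul det_adj2 det_add_Nmat Q R power2_eq_square)
  show "P ** R = Q + Nmat k j"
    unfolding P by (simp add: matrix_mul_assoc[symmetric] adj2_mult R)
qed

section \<open>Triples over a cluster and their neighbours in the tree\<close>

fun triple_at :: "(3 \<Rightarrow> nat) \<Rightarrow> (3 \<Rightarrow> ratfun) \<Rightarrow> (3 \<Rightarrow> 3) \<Rightarrow> triple \<Rightarrow> bool" where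
  "triple_at k c \<pi> (P, Q, R) \<longleftrightarrow>
     cgc_at k (\<pi> 1) (c (\<pi> 1)) P \<and> cgc_at k (\<pi> 2) (c (\<pi> 2)) Q \<and> cgc_at k (\<pi> 3) (c (\<pi> 3)) R \<and>
     Q = P ** R - Nmat k (\<pi> 2)"

lemma triple_at_D:
  assumes "triple_at k c \<pi> (P, Q, R)"
  shows "cgc_at k (\<pi> 1) (c (\<pi> 1)) P" "cgc_at k (\<pi> 2) (c (\<pi> 2)) Q" "cgc_at k (\<pi> 3) (c (\<pi> 3)) R"
    "Q = P ** R - Nmat k (\<pi> 2)"
  using assms unfolding triple_at.simps by blast+

lemma transpose_index3 [simp]:
  "Transposition.transpose 2 3 (1::3) = 1" "Transposition.transpose 2 3 (2::3) = 3"
  "Transposition.transpose 2 3 (3::3) = 2" "Transposition.transpose 1 2 (1::3) = 2"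
  "Transposition.transpose 1 2 (2::3) = 1" "Transposition.transpose 1 2 (3::3) = 3"
  by (simp_all add: Transposition.transpose_def)

text \<open>Both formulas use \<open>Smat\<close> rather than \<open>Nmat\<close>, so they mention
  no positions and can be compared between triples over different clusters.\<close>

lemma triple_at_recover:
  assumes "triple_at k c \<pi> (P, Q, R)"
  shows "P = (Q + Smat k Q) ** adj2 R" "R = adj2 P ** (Q + Smat k Q)"
proof -
  have "Q + Smat k Q = P ** R" "det P = 1" "det R = 1"
    using assms Smat_eq_Nmat[of k "\<pi> 2" "c (\<pi> 2)" Q] by (auto simp: cgc_at_def)
  then show "P = (Q + Smat k Q) ** adj2 R" "R = adj2 P ** (Q + Smat k Q)"
    by (simp_all add: matrix_mul_assoc[symmetric] adj2_mult) (simp add: matrix_mul_assoc adj2_mult)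
qed

text \<open>The quotient identities are read backwards: \<open>R\<close> is known, and it determines
  the trace and the (1,2)-entry of \<open>P ** Q\<close>.\<close>

lemma triple_at_left_child:
  assumes T: "triple_at k c \<pi> (P, Q, R)" and c: "labeled_cluster k c" and \<pi>: "bij \<pi>"
  shows "triple_at k (mutate k (\<pi> 3) c) (\<pi> \<circ> Transposition.transpose 2 3) (child k Left (P, Q, R))"
proof -
  note neq = bij_index3_neq[OF \<pi>]
  have PQR: "cgc_at k (\<pi> 1) (c (\<pi> 1)) P" "cgc_at k (\<pi> 2) (c (\<pi> 2)) Q" "cgc_at k (\<pi> 3) (c (\<pi> 3)) R"
    by (rule triple_at_D[OF T])+
  have R: "R = adj2 P ** (Q + Nmat k (\<pi> 2))"
    using triple_at_recover(2)[OF T] Smat_eq_Nmat[OF PQR(2)] by simp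
  note quotient = left_quotient[OF PQR(1,2) R]
  have "trace (P ** Q) = Mconst k * (P ** Q) $ 1 $ 2 + of_nat (k (\<pi> 3))"
    using quotient(2) cgc_at_D[OF PQR(3)] by (simp add: algebra_simps)
  moreover have "det (P ** Q) = 1"
    using PQR by (simp add: det_mul cgc_at_def)
  moreover have "(P ** Q) $ 1 $ 2 = mutate k (\<pi> 3) c (\<pi> 3)"
    using quotient(1) cgc_at_D(2)[OF PQR(3)] mutate_vieta[OF c, of "\<pi> 3" "\<pi> 1" "\<pi> 2"] neq
    by (simp add: algebra_simps)
  ultimately have "cgc_at k (\<pi> 3) (mutate k (\<pi> 3) c (\<pi> 3)) (P ** Q - Nmat k (\<pi> 3))"
    using cgc_at_diff_Nmat by metis
  then show ?thesis
    using PQR neq Smat_eq_Nmat[OF PQR(3)] by simp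
qed

lemma triple_at_right_child:
  assumes T: "triple_at k c \<pi> (P, Q, R)" and c: "labeled_cluster k c" and \<pi>: "bij \<pi>"
  shows "triple_at k (mutate k (\<pi> 1) c) (\<pi> \<circ> Transposition.transpose 1 2) (child k Right (P, Q, R))"
proof -
  note neq = bij_index3_neq[OF \<pi>]
  have PQR: "cgc_at k (\<pi> 1) (c (\<pi> 1)) P" "cgc_at k (\<pi> 2) (c (\<pi> 2)) Q" "cgc_at k (\<pi> 3) (c (\<pi> 3)) R"
    by (rule triple_at_D[OF T])+
  have P: "P = (Q + Nmat k (\<pi> 2)) ** adj2 R"
    using triple_at_recover(1)[OF T] Smat_eq_Nmat[OF PQR(2)] by simp
  note quotient = right_quotient[OF PQR(2,3) P]
  have "trace (Q ** R) = Mconst k * (Q ** R) $ 1 $ 2 + of_nat (k (\<pi> 1))"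
    using quotient(2) cgc_at_D[OF PQR(1)] by (simp add: algebra_simps)
  moreover have "det (Q ** R) = 1"
    using PQR by (simp add: det_mul cgc_at_def)
  moreover have "(Q ** R) $ 1 $ 2 = mutate k (\<pi> 1) c (\<pi> 1)"
    using quotient(1) cgc_at_D(2)[OF PQR(1)] mutate_vieta[OF c, of "\<pi> 1" "\<pi> 2" "\<pi> 3"] neq
    by (simp add: algebra_simps)
  ultimately have "cgc_at k (\<pi> 1) (mutate k (\<pi> 1) c (\<pi> 1)) (Q ** R - Nmat k (\<pi> 1))"
    using cgc_at_diff_Nmat by metis
  then show ?thesis
    using PQR neq Smat_eq_Nmat[OF PQR(1)] by simp
qed

text \<open>Now the quotient identities are read forwards: \<open>Q\<close> gives the trace and the
  (1,2)-entry of \<open>P ** R\<close>, and these give those of \<open>R'\<close>.\<close>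

lemma triple_at_left_parent:
  assumes T: "triple_at k c \<pi> (P, Q, R)" and c: "labeled_cluster k c" and \<pi>: "bij \<pi>"
    and R': "R' = adj2 P ** (R + Nmat k (\<pi> 3))"
  shows "triple_at k (mutate k (\<pi> 2) c) (\<pi> \<circ> Transposition.transpose 2 3) (P, R, R')"
    and "child k Left (P, R, R') = (P, Q, R)"
proof -
  note neq = bij_index3_neq[OF \<pi>]
  have PQR: "cgc_at k (\<pi> 1) (c (\<pi> 1)) P" "cgc_at k (\<pi> 2) (c (\<pi> 2)) Q" "cgc_at k (\<pi> 3) (c (\<pi> 3)) R"
    and Q: "Q = P ** R - Nmat k (\<pi> 2)"
    by (rule triple_at_D[OF T])+
  note quotient = left_quotient[OF PQR(1,3) R']
  note PR = trace_if_cgc_at_diff_Nmat[OF PQR(2)[unfolded Q]]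
  have "R' $ 1 $ 2 = mutate k (\<pi> 2) c (\<pi> 2)"
    using quotient(1) PR(1) mutate_vieta[OF c, of "\<pi> 2" "\<pi> 1" "\<pi> 3"] neq
    by (simp add: algebra_simps)
  then have R'_at: "cgc_at k (\<pi> 2) (mutate k (\<pi> 2) c (\<pi> 2)) R'"
    using quotient(2,3) PR(2) by (simp add: cgc_at_def)
  then show "triple_at k (mutate k (\<pi> 2) c) (\<pi> \<circ> Transposition.transpose 2 3) (P, R, R')"
    using PQR neq quotient(4) by simp
  show "child k Left (P, R, R') = (P, Q, R)"
    using Smat_eq_Nmat[OF R'_at] Q by simp
qed

lemma triple_at_right_parent:
  assumes T: "triple_at k c \<pi> (P, Q, R)" and c: "labeled_cluster k c" and \<pi>: "bij \<pi>"
    and P': "P' = (P + Nmat k (\<pi> 1)) ** adj2 R"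
  shows "triple_at k (mutate k (\<pi> 2) c) (\<pi> \<circ> Transposition.transpose 1 2) (P', P, R)"
    and "child k Right (P', P, R) = (P, Q, R)"
proof -
  note neq = bij_index3_neq[OF \<pi>]
  have PQR: "cgc_at k (\<pi> 1) (c (\<pi> 1)) P" "cgc_at k (\<pi> 2) (c (\<pi> 2)) Q" "cgc_at k (\<pi> 3) (c (\<pi> 3)) R"
    and Q: "Q = P ** R - Nmat k (\<pi> 2)"
    by (rule triple_at_D[OF T])+
  note quotient = right_quotient[OF PQR(1,3) P']
  note PR = trace_if_cgc_at_diff_Nmat[OF PQR(2)[unfolded Q]]
  have "P' $ 1 $ 2 = mutate k (\<pi> 2) c (\<pi> 2)"
    using quotient(1) PR(1) mutate_vieta[OF c, of "\<pi> 2" "\<pi> 1" "\<pi> 3"] neq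
    by (simp add: algebra_simps)
  then have P'_at: "cgc_at k (\<pi> 2) (mutate k (\<pi> 2) c (\<pi> 2)) P'"
    using quotient(2,3) PR(2) by (simp add: cgc_at_def)
  then show "triple_at k (mutate k (\<pi> 2) c) (\<pi> \<circ> Transposition.transpose 1 2) (P', P, R)"
    using PQR neq quotient(4) by simp
  show "child k Right (P', P, R) = (P, Q, R)"
    using Smat_eq_Nmat[OF P'_at] Q by simp
qed

section \<open>The root of the tree\<close>

lemma det_complete_SL2 [simp]: "b \<noteq> 0 \<Longrightarrow> det (complete_SL2 a b d) = 1"
  by (simp add: complete_SL2_def det_2)

lemma complete_SL2_nth [simp]:
  "complete_SL2 a b d $ 1 $ 1 = a" "complete_SL2 a b d $ 1 $ 2 = b" "complete_SL2 a b d $ 2 $ 2 = d"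
  by (simp_all add: complete_SL2_def)

lemma Mconst_bij:
  fixes \<tau> :: "3 \<Rightarrow> 3"
  assumes "bij \<tau>"
  shows "Mconst k = ((var (\<tau> 1))\<^sup>2 + (var (\<tau> 2))\<^sup>2 + (var (\<tau> 3))\<^sup>2
      + of_nat (k (\<tau> 1)) * var (\<tau> 2) * var (\<tau> 3) + of_nat (k (\<tau> 2)) * var (\<tau> 1) * var (\<tau> 3)
      + of_nat (k (\<tau> 3)) * var (\<tau> 1) * var (\<tau> 2)) / (var (\<tau> 1) * var (\<tau> 2) * var (\<tau> 3))"
proof -
  note neq = bij_index3_neq[OF assms]
  show ?thesis
    using markov_distinct[OF labeled_cluster.initial neq, of k] by (simp add: divide_simps algebra_simps)
qed

lemma cgc_at_Pmat:
  assumes "bij \<tau>"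
  shows "cgc_at k (\<tau> 1) (var (\<tau> 1)) (Pmat k \<tau> f)" "Pmat k \<tau> f $ 1 $ 1 = f"
  unfolding cgc_at_def Mconst_bij[OF assms] Pmat_def Let_def trace_2
  by (auto simp: divide_simps)

lemma cgc_at_Qmat:
  assumes "bij \<tau>"
  shows "cgc_at k (\<tau> 2) (var (\<tau> 2)) (Qmat k \<tau> f)"
    "Qmat k \<tau> f $ 2 $ 2 =
      (- f * var (\<tau> 2) * var (\<tau> 3) + of_nat (k (\<tau> 3)) * var (\<tau> 1) * var (\<tau> 2) + var (\<tau> 1) ^ 2 + var (\<tau> 2) ^ 2)
        / (var (\<tau> 1) * var (\<tau> 3))"
  unfolding cgc_at_def Mconst_bij[OF assms] Qmat_def Let_def trace_2
  by (auto simp: divide_simps) (simp add: algebra_simps power2_eq_square)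

lemma cgc_at_Rmat:
  assumes "bij \<tau>"
  shows "cgc_at k (\<tau> 3) (var (\<tau> 3)) (Rmat k \<tau> f)"
  unfolding cgc_at_def Mconst_bij[OF assms] Rmat_def Let_def trace_2
  by (auto simp: divide_simps)

text \<open>Fricke-type identity: the (2,1)-entries are eliminated through the determinants.\<close>

lemma trace_mult_markov:
  assumes P: "cgc_at k i p P" and R: "cgc_at k l r R" and q: "(P ** R) $ 1 $ 2 = q"
    and nz: "p \<noteq> 0" "r \<noteq> 0"
    and markov: "p\<^sup>2 + q\<^sup>2 + r\<^sup>2 + of_nat (k i) * q * r + of_nat (k j) * p * r + of_nat (k l) * p * q
      = Mconst k * p * q * r"
  shows "trace (P ** R) = Mconst k * q + of_nat (k j)"
proof -
  note P = cgc_at_D[OF P] and R = cgc_at_D[OF R]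
  have p22: "P $ 2 $ 2 = Mconst k * p - of_nat (k i) - P $ 1 $ 1"
    using P(3) by (simp add: trace_2 algebra_simps)
  have r11: "R $ 1 $ 1 = Mconst k * r - of_nat (k l) - R $ 2 $ 2"
    using R(3) by (simp add: trace_2 algebra_simps)
  have p21: "p * P $ 2 $ 1 = P $ 1 $ 1 * P $ 2 $ 2 - 1" and r21: "r * R $ 2 $ 1 = R $ 1 $ 1 * R $ 2 $ 2 - 1"
    using P(1,2) R(1,2) by (simp_all add: det_2 algebra_simps)
  have q': "P $ 1 $ 1 * r + p * R $ 2 $ 2 = q"
    using q P(2) R(2) by (simp add: mult_2_nth)
  have "p * r * trace (P ** R)
      = p * r * (P $ 1 $ 1 * R $ 1 $ 1 + P $ 2 $ 2 * R $ 2 $ 2) + p\<^sup>2 * (r * R $ 2 $ 1) + r\<^sup>2 * (p * P $ 2 $ 1)"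
    by (simp add: entries_2 P R algebra_simps power2_eq_square)
  also have "\<dots> = (P $ 1 $ 1 * r + p * R $ 2 $ 2) * (p * R $ 1 $ 1 + r * P $ 2 $ 2) - p\<^sup>2 - r\<^sup>2"
    unfolding p21 r21 by (simp add: algebra_simps power2_eq_square)
  also have "\<dots> = q * (2 * Mconst k * p * r - of_nat (k l) * p - of_nat (k i) * r - q) - p\<^sup>2 - r\<^sup>2"
  proof -
    have "p * R $ 1 $ 1 + r * P $ 2 $ 2 = 2 * Mconst k * p * r - of_nat (k l) * p - of_nat (k i) * r - q"
      unfolding p22 r11 q'[symmetric] by (simp add: algebra_simps)
    then show ?thesis
      using q' by simp
  qed
  also have "\<dots> = p * r * (Mconst k * q + of_nat (k j))"
    using markov by (simp add: algebra_simps power2_eq_square)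
  finally show ?thesis
    using nz by simp
qed

lemma bij_comp_transpose: "bij \<sigma> \<Longrightarrow> bij (\<sigma> \<circ> Transposition.transpose i j)"
  by (simp add: bij_comp)

text \<open>The root has the form of the left child of the matrices \<open>Pmat\<close>,
  \<open>Qmat\<close>, \<open>Rmat\<close> in the order
  \<open>\<sigma> \<circ> Transposition.transpose 2 3\<close>. Passing to that child undoes the
  transposition, which leaves the order \<open>\<sigma>\<close>.\<close>

lemma triple_at_root:
  assumes \<sigma>: "bij \<sigma>"
  shows "triple_at k (mutate k (\<sigma> 2) var) \<sigma> (cgct_root k \<sigma> f)"
proof -
  define \<tau> where "\<tau> = \<sigma> \<circ> Transposition.transpose 2 3"
  have \<tau>: "bij \<tau>" "\<tau> 1 = \<sigma> 1" "\<tau> 2 = \<sigma> 3" "\<tau> 3 = \<sigma> 2"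
    using \<sigma> by (simp_all add: \<tau>_def bij_comp_transpose)
  note neq = bij_index3_neq[OF \<sigma>]
  let ?P = "Pmat k \<tau> f" and ?R = "Qmat k \<tau> f" and ?c = "mutate k (\<sigma> 2) var"
  note P = cgc_at_Pmat[OF \<tau>(1), of k f, unfolded \<tau>(2-4)]
    and R = cgc_at_Qmat[OF \<tau>(1), of k f, unfolded \<tau>(2-4)]
    and N = cgc_at_Rmat[OF \<tau>(1), of k f, unfolded \<tau>(2-4)]
  have q: "(?P ** ?R) $ 1 $ 2 = ?c (\<sigma> 2)"
    using neq mutate_eq[of "\<sigma> 2" "\<sigma> 1" "\<sigma> 3" k var]
    by (simp add: mult_2_nth P(2) R(2) cgc_at_D(2)[OF P(1)] cgc_at_D(2)[OF R(1)] quad_def divide_simps)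
  have markov: "(var (\<sigma> 1))\<^sup>2 + (?c (\<sigma> 2))\<^sup>2 + (var (\<sigma> 3))\<^sup>2 + of_nat (k (\<sigma> 1)) * ?c (\<sigma> 2) * var (\<sigma> 3)
      + of_nat (k (\<sigma> 2)) * var (\<sigma> 1) * var (\<sigma> 3) + of_nat (k (\<sigma> 3)) * var (\<sigma> 1) * ?c (\<sigma> 2)
      = Mconst k * var (\<sigma> 1) * ?c (\<sigma> 2) * var (\<sigma> 3)"
    using markov_distinct[OF labeled_cluster.mutation[OF labeled_cluster.initial] neq, of k "\<sigma> 2"] neq
    by simp
  \<comment> \<open>No triple above the root is at hand to supply this trace, so it is derived from
    the equation of the mutated cluster.\<close>
  have "trace (?P ** ?R) = Mconst k * ?c (\<sigma> 2) + of_nat (k (\<sigma> 2))"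
    by (rule trace_mult_markov[OF P(1) R(1) q _ _ markov]) simp_all
  moreover have "det (?P ** ?R) = 1"
    using P R by (simp add: det_mul cgc_at_def)
  ultimately have "cgc_at k (\<sigma> 2) (?c (\<sigma> 2)) (?P ** ?R - Nmat k (\<sigma> 2))"
    using q cgc_at_diff_Nmat by metis
  then show ?thesis
    using P R neq Smat_eq_Nmat[OF N] by (simp add: cgct_root_def \<tau>_def[symmetric])
qed

lemma triple_at_eq_root:
  assumes T: "triple_at k (mutate k (\<sigma> 2) var) \<sigma> (P, Q, R)" and \<sigma>: "bij \<sigma>"
  shows "(P, Q, R) = cgct_root k \<sigma> (P $ 1 $ 1)"
proof -
  obtain P' Q' R' where root: "cgct_root k \<sigma> (P $ 1 $ 1) = (P', Q', R')"
    by (metis prod_cases3)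
  note neq = bij_index3_neq[OF \<sigma>]
  note T' = triple_at_root[OF \<sigma>, of k "P $ 1 $ 1", unfolded root]
  have "P' $ 1 $ 1 = P $ 1 $ 1"
    using root cgc_at_Pmat(2)[OF bij_comp_transpose[OF \<sigma>]] by (auto simp: cgct_root_def Let_def)
  then have P: "P = P'"
    using T T' neq by (intro cgc_at_eqI[of k "\<sigma> 1" "var (\<sigma> 1)"]) simp_all
  \<comment> \<open>With \<open>P\<close> fixed, this entry is affine in the (2,2)-entry of
    \<open>R\<close> with nonzero slope, so it determines that entry and thereby
    \<open>R\<close>.\<close>
  have "(P ** R) $ 1 $ 2 = (P ** R') $ 1 $ 2"
    using T T' trace_if_cgc_at_diff_Nmat(1) P by (metis triple_at.simps)
  then have "R $ 2 $ 2 = R' $ 2 $ 2"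
    using T T' neq by (simp add: mult_2_nth cgc_at_def)
  then have "R = R'"
    using T T' neq by (intro cgc_at_eqI[of k "\<sigma> 3" "var (\<sigma> 3)"]) simp_all
  then show ?thesis
    using P T T' root by simp
qed

section \<open>Existence\<close>

lemma laurent_to_fract: "to_fract p \<in> laurent"
  unfolding laurent_def by (intro CollectI exI[of _ p] exI[of _ "0 :: nat"]) simp

lemma laurent_of_nat [simp]: "of_nat n \<in> laurent"
  using laurent_to_fract[of "of_nat n"] by (simp add: to_fract_of_nat)

lemma var_in_laurent: "var i \<in> laurent"
  by (auto simp: var_def laurent_to_fract)

lemma laurent_mult [intro]:
  assumes "a \<in> laurent" "b \<in> laurent"
  shows "a * b \<in> laurent"
proof -
  obtain p m q n where "a = to_fract p / (var 1 * var 2 * var 3) ^ m" "b = to_fract q / (var 1 * var 2 * var 3) ^ n"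
    using assms unfolding laurent_def by blast
  then have "a * b = to_fract (p * q) / (var 1 * var 2 * var 3) ^ (m + n)"
    by (simp add: power_add)
  then show ?thesis
    unfolding laurent_def by blast
qed

lemma laurent_uminus [intro]:
  assumes "a \<in> laurent"
  shows "- a \<in> laurent"
proof -
  obtain p n where "a = to_fract p / (var 1 * var 2 * var 3) ^ n"
    using assms unfolding laurent_def by blast
  then have "- a = to_fract (- p) / (var 1 * var 2 * var 3) ^ n"
    by simp
  then show ?thesis
    unfolding laurent_def by blast
qed

lemma laurent_add [intro]:
  assumes "a \<in> laurent" "b \<in> laurent"
  shows "a + b \<in> laurent"
proof -
  define w where "w = [:0, 1:] * [:[:0, 1:]:] * ([:[:[:0, 1:]:]:] :: int poly poly poly)"
  have w: "var 1 * var 2 * var 3 = to_fract w"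
    unfolding w_def to_fract_mult by (simp add: var_def)
  have nz: "to_fract w \<noteq> 0"
    by (simp add: w_def)
  obtain p m q n where ab: "a = to_fract p / to_fract w ^ m" "b = to_fract q / to_fract w ^ n"
    using assms unfolding laurent_def w by blast
  have "a + b = to_fract (p * w ^ n + q * w ^ m) / to_fract w ^ (m + n)"
    unfolding ab using nz by (simp add: to_fract_power add_frac_eq power_add)
  then show ?thesis
    unfolding laurent_def w by blast
qed

lemma laurent_diff [intro]: "a \<in> laurent \<Longrightarrow> b \<in> laurent \<Longrightarrow> a - b \<in> laurent"
  using laurent_add[of a "- b"] by auto

lemma Mconst_in_laurent: "Mconst k \<in> laurent"
proof -
  have "1 / (var 1 * var 2 * var 3) = to_fract 1 / (var 1 * var 2 * var 3) ^ 1"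
    by simp
  then have inv: "1 / (var 1 * var 2 * var 3) \<in> laurent"
    unfolding laurent_def by blast
  have "Mconst k = (var 1 * var 1 + var 2 * var 2 + var 3 * var 3
      + of_nat (k 1) * var 2 * var 3 + of_nat (k 2) * var 1 * var 3 + of_nat (k 3) * var 1 * var 2)
      * (1 / (var 1 * var 2 * var 3))"
    by (simp add: Mconst_def power2_eq_square)
  also have "\<dots> \<in> laurent"
    by (intro laurent_mult laurent_add inv var_in_laurent laurent_of_nat)
  finally show ?thesis .
qed

definition laurent_mat :: "mat \<Rightarrow> bool" where
  "laurent_mat P \<longleftrightarrow> (\<forall>i j. P $ i $ j \<in> laurent)"

lemma laurent_mat_quotients:
  assumes "laurent_mat P" "laurent_mat Q"
  shows "laurent_mat (adj2 P ** (Q + Nmat k j))" "laurent_mat ((P + Nmat k j) ** adj2 Q)"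
  using assms Mconst_in_laurent
  by (auto simp: laurent_mat_def forall_2 mult_2_nth adj2_def intro!: laurent_diff laurent_add laurent_mult laurent_uminus)

lemma cgct_snoc: "cgct k \<sigma> f (v @ [b]) = child k b (cgct k \<sigma> f v)"
  by (simp add: cgct_def)

text \<open>Either parent consists of the two outer matrices and one adjugate quotient of them, so
  the Laurent condition travels up to the (1,1)-entry at the root.\<close>

lemma exists_vertex:
  assumes "reduced_cluster k c i" "bij \<pi>" "\<pi> 2 = i" "triple_at k c \<pi> (P, Q, R)" "laurent_mat P" "laurent_mat R"
  shows "\<exists>f \<sigma> v. f \<in> laurent \<and> bij \<sigma> \<and> cgct k \<sigma> f v = (P, Q, R)"
  using assms
proof (induction arbitrary: \<pi> P Q R rule: reduced_cluster.induct)
  case (first i)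
  then have "cgct k \<pi> (P $ 1 $ 1) [] = (P, Q, R)"
    using triple_at_eq_root[of k \<pi> P Q R] by (simp add: cgct_def del: triple_at.simps)
  moreover have "P $ 1 $ 1 \<in> laurent"
    using first(4) by (simp add: laurent_mat_def)
  ultimately show ?case
    using first(1) by blast
next
  case (step c i j)
  note c = reduced_cluster_labeled[OF step.hyps(1)]
  note c' = labeled_cluster.mutation[OF c, of "\<pi> 2"]
  have T: "triple_at k (mutate k (\<pi> 2) c) \<pi> (P, Q, R)"
    using step.prems by (simp del: triple_at.simps)
  \<comment> \<open>The parent must have the former maximum \<open>i\<close> in the middle: a triple
    with \<open>i\<close> at its left end is a right child, one with \<open>i\<close> at its right
    end a left child.\<close>
  have "i = \<pi> 1 \<or> i = \<pi> 3"
    using index3_distinct_cases[OF bij_index3_neq[OF step.prems(1)]] exhaust_3[of i] step.hyps(2) step.prems(2)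
    by auto
  then show ?case
  proof
    assume i: "i = \<pi> 1"
    define P' where "P' = (P + Nmat k (\<pi> 1)) ** adj2 R"
    note parent = triple_at_right_parent[OF T c' step.prems(1) P'_def, unfolded mutate_mutate[OF c]]
    have "laurent_mat P'"
      unfolding P'_def using step.prems by (intro laurent_mat_quotients)
    then obtain f \<sigma> v where "f \<in> laurent" "bij \<sigma>" "cgct k \<sigma> f v = (P', P, R)"
      using step.IH[OF bij_comp_transpose[OF step.prems(1)] _ parent(1)] step.prems(5) by (auto simp: i)
    then show ?thesis
      using cgct_snoc[of k \<sigma> f v Right] parent(2) by metis
  next
    assume i: "i = \<pi> 3"
    define R' where "R' = adj2 P ** (R + Nmat k (\<pi> 3))"
    note parent = triple_at_left_parent[OF T c' step.prems(1) R'_def, unfolded mutate_mutate[OF c]]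
    have "laurent_mat R'"
      unfolding R'_def using step.prems by (intro laurent_mat_quotients)
    then obtain f \<sigma> v where "f \<in> laurent" "bij \<sigma>" "cgct k \<sigma> f v = (P, R, R')"
      using step.IH[OF bij_comp_transpose[OF step.prems(1)] _ parent(1)] step.prems(4) by (auto simp: i)
    then show ?thesis
      using cgct_snoc[of k \<sigma> f v Left] parent(2) by metis
  qed
qed

section \<open>Uniqueness\<close>

text \<open>A child mutates an outer position and moves it to the middle. The old middle was the
  last mutated position, so the word stays reduced.\<close>

lemma vertex_triple_at:
  assumes "bij \<sigma>"
  shows "\<exists>c \<pi>. bij \<pi> \<and> reduced_cluster k c (\<pi> 2) \<and> triple_at k c \<pi> (cgct k \<sigma> f v)"
proof (induction v rule: rev_induct)
  case Nil
  have "cgct k \<sigma> f [] = cgct_root k \<sigma> f"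
    by (simp add: cgct_def)
  then show ?case
    using assms triple_at_root[OF assms, of k f] reduced_cluster.first[of k "\<sigma> 2"] by metis
next
  case (snoc b v)
  then obtain c \<pi> where \<pi>: "bij \<pi>" and c: "reduced_cluster k c (\<pi> 2)" and T: "triple_at k c \<pi> (cgct k \<sigma> f v)"
    by blast
  obtain P Q R where PQR: "cgct k \<sigma> f v = (P, Q, R)"
    by (metis prod_cases3)
  note neq = bij_index3_neq[OF \<pi>]
  show ?case
  proof (cases b)
    case Left
    have "reduced_cluster k (mutate k (\<pi> 3) c) ((\<pi> \<circ> Transposition.transpose 2 3) 2)"
      using reduced_cluster.step[OF c, of "\<pi> 3"] neq by simp
    then show ?thesis
      using triple_at_left_child[OF T[unfolded PQR] reduced_cluster_labeled[OF c] \<pi>] bij_comp_transpose[OF \<pi>]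
      unfolding cgct_snoc PQR Left by blast
  next
    case Right
    have "reduced_cluster k (mutate k (\<pi> 1) c) ((\<pi> \<circ> Transposition.transpose 1 2) 2)"
      using reduced_cluster.step[OF c, of "\<pi> 1"] neq by simp
    then show ?thesis
      using triple_at_right_child[OF T[unfolded PQR] reduced_cluster_labeled[OF c] \<pi>] bij_comp_transpose[OF \<pi>]
      unfolding cgct_snoc PQR Right by blast
  qed
qed

text \<open>The outer entries of the triple at a vertex tell by which branch the vertex was entered.\<close>

lemma vertex_branch:
  assumes "bij \<sigma>" "cgct k \<sigma> f v = (P, Q, R)"
  obtains p r where "has_value (P $ 1 $ 2) p" "has_value (R $ 1 $ 2) r"
    "v = [] \<Longrightarrow> p = r" "v \<noteq> [] \<Longrightarrow> last v = Left \<Longrightarrow> p < r" "v \<noteq> [] \<Longrightarrow> last v = Right \<Longrightarrow> r < p"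
proof (cases v rule: rev_exhaust)
  case Nil
  note neq = bij_index3_neq[OF assms(1)]
  have "triple_at k (mutate k (\<sigma> 2) var) \<sigma> (P, Q, R)"
    using triple_at_root[OF assms(1)] assms(2) Nil by (metis cgct_def fold_simps(1))
  then have "P $ 1 $ 2 = var (\<sigma> 1)" "R $ 1 $ 2 = var (\<sigma> 3)"
    using neq by (simp_all add: cgc_at_def)
  then show ?thesis
    using that[of 1 1] has_value_var Nil by simp
next
  case (snoc w b)
  obtain P' Q' R' where w: "cgct k \<sigma> f w = (P', Q', R')"
    by (metis prod_cases3)
  obtain c \<pi> where \<pi>: "bij \<pi>" and c: "reduced_cluster k c (\<pi> 2)" and T: "triple_at k c \<pi> (P', Q', R')"
    using vertex_triple_at[OF assms(1), of k f w] w by auto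
  note neq = bij_index3_neq[OF \<pi>]
  obtain x y z where xyz: "has_value (c (\<pi> 1)) x" "has_value (c (\<pi> 2)) y" "has_value (c (\<pi> 3)) z"
    using labeled_cluster_has_value[OF reduced_cluster_labeled[OF c]] by blast
  \<comment> \<open>The old middle matrix survives as an outer one, on the right of a left child and
    on the left of a right child; carrying the maximum, it decides the comparison.\<close>
  have "x < y" "z < y"
    using reduced_cluster_max[OF c] xyz neq by metis+
  moreover have "P' $ 1 $ 2 = c (\<pi> 1)" "Q' $ 1 $ 2 = c (\<pi> 2)" "R' $ 1 $ 2 = c (\<pi> 3)"
    using triple_at_D(1-3)[OF T] by (simp_all add: cgc_at_def)
  moreover have "(P, Q, R) = child k b (P', Q', R')"
    using assms(2) w snoc cgct_snoc by metis
  ultimately show ?thesis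
    using that xyz snoc by (cases b) auto
qed

text \<open>A child contains the middle and one outer matrix of its parent, and these two determine
  the third.\<close>

lemma child_inj:
  assumes "triple_at k c \<pi> T" "triple_at k c' \<pi>' T'" "child k b T = child k b T'"
  shows "T = T'"
proof -
  obtain P Q R where T: "T = (P, Q, R)"
    by (metis prod_cases3)
  obtain P' Q' R' where T': "T' = (P', Q', R')"
    by (metis prod_cases3)
  note rec = triple_at_recover[OF assms(1)[unfolded T]] and rec' = triple_at_recover[OF assms(2)[unfolded T']]
  show ?thesis
  proof (cases b)
    case Left
    then have "P = P'" "Q = Q'"
      using assms(3) T T' by simp_all
    then show ?thesis
      using rec(2) rec'(2) T T' by simp
  next
    case Right
    then have "Q = Q'" "R = R'"
      using assms(3) T T' by simp_all
    then show ?thesis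
      using rec(1) rec'(1) T T' by simp
  qed
qed

lemma var_inj: "var i = var j \<Longrightarrow> i = j"
  using cluster_position_unique[OF labeled_cluster.initial labeled_cluster.initial] .

lemma root_inj:
  assumes "bij \<sigma>" "bij \<sigma>'" "cgct_root k \<sigma> f = cgct_root k \<sigma>' f'"
  shows "\<sigma> = \<sigma>'" "f = f'"
proof -
  obtain P Q R where root: "cgct_root k \<sigma> f = (P, Q, R)"
    by (metis prod_cases3)
  note neq = bij_index3_neq[OF assms(1)] and neq' = bij_index3_neq[OF assms(2)]
  have T: "triple_at k (mutate k (\<sigma> 2) var) \<sigma> (P, Q, R)" "triple_at k (mutate k (\<sigma>' 2) var) \<sigma>' (P, Q, R)"
    using triple_at_root[OF assms(1), of k f] triple_at_root[OF assms(2), of k f'] assms(3) root by simp_all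
  then have "var (\<sigma> 1) = var (\<sigma>' 1)" "var (\<sigma> 3) = var (\<sigma>' 3)"
    using neq neq' by (auto simp: cgc_at_def)
  then have "\<sigma> 1 = \<sigma>' 1" "\<sigma> 3 = \<sigma>' 3"
    using var_inj by blast+
  moreover from this have "\<sigma> 2 = \<sigma>' 2"
    using index3_distinct_cases[OF neq] index3_distinct_cases[OF neq'] by auto
  ultimately show "\<sigma> = \<sigma>'"
    using exhaust_3 by (metis ext)
  have "P = Pmat k (\<sigma> \<circ> Transposition.transpose 2 3) f" "P = Pmat k (\<sigma>' \<circ> Transposition.transpose 2 3) f'"
    using root assms(3) by (simp_all add: cgct_root_def Let_def)
  then show "f = f'"
    using cgc_at_Pmat(2)[OF bij_comp_transpose[OF assms(1)], of k 2 3 f]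
      cgc_at_Pmat(2)[OF bij_comp_transpose[OF assms(2)], of k 2 3 f'] by simp
qed

text \<open>The outer values of the common triple tie only at a root; otherwise they force the same
  last branch on both sides, and cancelling it shortens both words.\<close>

lemma vertex_inj:
  assumes "bij \<sigma>" "bij \<sigma>'" "cgct k \<sigma> f v = cgct k \<sigma>' f' v'"
  shows "f = f' \<and> \<sigma> = \<sigma>' \<and> v = v'"
  using assms(3)
proof (induction v arbitrary: v' rule: rev_induct)
  case Nil
  obtain P Q R where PQR: "cgct k \<sigma> f [] = (P, Q, R)"
    by (metis prod_cases3)
  obtain p r where 1: "has_value (P $ 1 $ 2) p" "has_value (R $ 1 $ 2) r" "p = r"
    using vertex_branch[OF assms(1) PQR] by metis
  obtain p' r' where 2: "has_value (P $ 1 $ 2) p'" "has_value (R $ 1 $ 2) r'"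
    "v' \<noteq> [] \<Longrightarrow> last v' = Left \<Longrightarrow> p' < r'" "v' \<noteq> [] \<Longrightarrow> last v' = Right \<Longrightarrow> r' < p'"
    using vertex_branch[OF assms(2)] PQR Nil by metis
  have "p = p'" "r = r'"
    using 1 2 has_value_unique by blast+
  then have "v' = []"
    using 1 2 by (cases "last v'") auto
  then show ?case
    using root_inj[OF assms(1,2)] Nil by (simp add: cgct_def)
next
  case (snoc b v)
  obtain P Q R where PQR: "cgct k \<sigma> f (v @ [b]) = (P, Q, R)"
    by (metis prod_cases3)
  obtain p r where 1: "has_value (P $ 1 $ 2) p" "has_value (R $ 1 $ 2) r" "b = Left \<Longrightarrow> p < r" "b = Right \<Longrightarrow> r < p"
    using vertex_branch[OF assms(1) PQR] by (metis last_snoc snoc_eq_iff_butlast)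
  obtain p' r' where 2: "has_value (P $ 1 $ 2) p'" "has_value (R $ 1 $ 2) r'" "v' = [] \<Longrightarrow> p' = r'"
    "v' \<noteq> [] \<Longrightarrow> last v' = Left \<Longrightarrow> p' < r'" "v' \<noteq> [] \<Longrightarrow> last v' = Right \<Longrightarrow> r' < p'"
    using vertex_branch[OF assms(2)] PQR snoc.prems by metis
  have "p = p'" "r = r'"
    using 1 2 has_value_unique by blast+
  then have "v' \<noteq> []" "last v' = b"
    using 1 2 by (cases b; cases "last v'"; force)+
  then obtain w where v': "v' = w @ [b]"
    by (metis append_butlast_last_id)
  have "cgct k \<sigma> f v = cgct k \<sigma>' f' w"
    using vertex_triple_at[OF assms(1), of k f v] vertex_triple_at[OF assms(2), of k f' w]
      snoc.prems child_inj unfolding v' cgct_snoc by blast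
  then show ?case
    using snoc.IH v' by blast
qed

theorem theorem4p13:
  fixes k :: "3 \<Rightarrow> nat" and P Q R :: mat and a b c :: ratfun
  assumes "cgc_triple k (P, Q, R)"
    and "associated_cluster (P, Q, R) = (a, b, c)"
    and "val1 b > max (val1 a) (val1 c)"
  shows "\<exists>!(f, \<sigma>, v). f \<in> laurent \<and> bij \<sigma> \<and> cgct k \<sigma> f v = (P, Q, R)"
proof -
  obtain d and \<pi> :: "3 \<Rightarrow> 3" where d: "labeled_cluster k d" and \<pi>: "bij \<pi>"
    and abc: "a = d (\<pi> 1)" "b = d (\<pi> 2)" "c = d (\<pi> 3)"
    using assms(1,2) unfolding cgc_triple.simps nonlabeled_cluster_def by auto
  have entries: "P $ 1 $ 2 = d (\<pi> 1)" "Q $ 1 $ 2 = d (\<pi> 2)" "R $ 1 $ 2 = d (\<pi> 3)"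
    using assms(2) abc by simp_all
  have cgc: "cgc_matrix k P" "cgc_matrix k Q" "cgc_matrix k R" and Q: "Q = P ** R - Smat k Q"
    using assms(1) by simp_all
  \<comment> \<open>Uniqueness of positions turns the parities in the trace conditions into the
    parameters at \<open>\<pi> 1\<close>, \<open>\<pi> 2\<close> and \<open>\<pi> 3\<close>.\<close>
  have at: "cgc_at k (\<pi> 1) (d (\<pi> 1)) P" "cgc_at k (\<pi> 2) (d (\<pi> 2)) Q" "cgc_at k (\<pi> 3) (d (\<pi> 3)) R"
    using cgc unfolding cgc_matrix_def SL2_laurent_def cgc_at_def entries
    by (simp_all add: parity_cluster_variable[OF d])
  then have T: "triple_at k d \<pi> (P, Q, R)"
    using Q Smat_eq_Nmat[OF at(2)] by simp
  have laurent: "laurent_mat P" "laurent_mat Q" "laurent_mat R"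
    using cgc by (simp_all add: cgc_matrix_def SL2_laurent_def laurent_mat_def)
  \<comment> \<open>This gives \<open>val1\<close> its meaning on the three entries and transfers
    the inequality to the values of the cluster.\<close>
  then have "a \<in> laurent" "b \<in> laurent" "c \<in> laurent"
    using assms(2) by (auto simp: laurent_mat_def)
  note vals = this[THEN has_value_val1]
  have "reduced_cluster k d (\<pi> 2)"
  proof (rule reduced_cluster_if_max[OF d])
    show "has_value (d (\<pi> 2)) (of_int (val1 b))"
      using vals abc by simp
    fix j v
    assume "j \<noteq> \<pi> 2" "has_value (d j) v"
    moreover from this have "j = \<pi> 1 \<or> j = \<pi> 3"
      using index3_distinct_cases[OF bij_index3_neq[OF \<pi>]] exhaust_3[of j] by auto
    ultimately have "v = of_int (val1 a) \<or> v = of_int (val1 c)"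
      using vals abc has_value_unique by blast
    then show "v < of_int (val1 b)"
      using assms(3) by auto
  qed
  then obtain f \<sigma> v where "f \<in> laurent" "bij \<sigma>" "cgct k \<sigma> f v = (P, Q, R)"
    using exists_vertex[OF _ \<pi> refl T laurent(1,3)] by blast
  then show ?thesis
    by (intro ex1I[of _ "(f, \<sigma>, v)"]) (auto dest: vertex_inj[where k = k and \<sigma>' = \<sigma> and f' = f and v' = v])
qed

end
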